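(* Let $\tilde H(t)=H_B+\tilde H_{\rm err}(t)$, $t\in[0,T]$, be a toggling-frame Hamiltonian with $H_B=\mathbb I_S\otimes B_0$, $\|H_B\|\le\beta$, $\|\tilde H_{\rm err}(t)\|\le J$ for all $t$, and $\epsilon=\beta+J$. Let $\tilde U(T)$ be the time evolution operator on $[0,T]$ generated by $\tilde H(t)$, and suppose that for some $n\ge1$ the control sequence achieves $n$th-order decoupling, i.e. the Magnus terms $\Omega_1(T),\dots,\Omega_n(T)$ of $\tilde H$ are all pure-bath operators. Then there is an operator $B$ on the bath (not necessarily unitary) such that $$\left\|\tilde U(T)-\mathbb I_S\otimes B\right\|\le\sum_{m=n+1}^\infty\frac{1}{(m-1)!}(JT)(\epsilon T)^{m-1}.$$
   Context: Operators are bounded on $\mathcal H_S\otimes\mathcal H_B$ (system $\otimes$ bath), $\|\cdot\|$ is the operator norm; $\tilde H(t)$ is Hermitian and piecewise continuous; $\tilde U$ solves $\frac{d}{dt}\tilde U(t)=-i\tilde H(t)\tilde U(t)$, $\tilde U(0)=\mathbb I$. An operator is pure-bath if it has the form $\mathbb I_S\otimes B$. The Magnus terms $\Omega_n(T)$ are the coefficients in the expansion $\tilde U_\lambda(T)=\exp\big(\sum_{n\ge1}\lambda^n\Omega_n(T)\big)$ (for small $\lambda$) of the logarithm of the evolution operator generated by $\lambda\tilde H(t)$. In the paper, pulses have zero width, and the norm of the part of the evolution not of the form $\mathbb I_S\otimes B$ (the "bad part") is the effective noise strength $\eta_{\rm DD}$. *)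

theory Defs
  imports "HOL-Analysis.Analysis"
begin

section \<open>Complex Hilbert spaces\<close>

class scaleC = scaleR +
  fixes scaleC :: "complex \<Rightarrow> 'a \<Rightarrow> 'a" (infixr "*\<^sub>C" 75)

class complex_vector = scaleC + real_vector +
  assumes scaleC_add_right: "a *\<^sub>C (x + y) = a *\<^sub>C x + a *\<^sub>C y"
    and scaleC_add_left: "(a + b) *\<^sub>C x = a *\<^sub>C x + b *\<^sub>C x"
    and scaleC_scaleC: "a *\<^sub>C (b *\<^sub>C x) = (a * b) *\<^sub>C x"
    and scaleR_scaleC: "r *\<^sub>R x = complex_of_real r *\<^sub>C x"

text \<open>The inner product is antilinear in the first and linear in the second argument;
  positivity and definiteness are contained in the last axiom.\<close>

class chilbert_space = complex_vector + banach +
  fixes cinner :: "'a \<Rightarrow> 'a \<Rightarrow> complex"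
  assumes cinner_commute: "cinner x y = cnj (cinner y x)"
    and cinner_add_right: "cinner x (y + z) = cinner x y + cinner x z"
    and cinner_scaleC_right: "cinner x (a *\<^sub>C y) = a * cinner x y"
    and cinner_same: "cinner x x = complex_of_real ((norm x)\<^sup>2)"

lemma norm_scaleC: "norm (a *\<^sub>C x) = cmod a * norm (x :: 'a::chilbert_space)"
proof -
  have "cinner (a *\<^sub>C x) (a *\<^sub>C x) = a * cnj a * cinner x x"
    by (metis cinner_commute cinner_scaleC_right complex_cnj_mult mult.assoc)
  then have "complex_of_real ((norm (a *\<^sub>C x))\<^sup>2) = complex_of_real ((cmod a * norm x)\<^sup>2)"
    unfolding cinner_same power_mult_distrib of_real_mult complex_norm_square[symmetric] .
  then have "(norm (a *\<^sub>C x))\<^sup>2 = (cmod a * norm x)\<^sup>2"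
    using of_real_eq_iff by blast
  then show ?thesis
    by (simp add: power2_eq_iff_nonneg)
qed

lemma bounded_linear_scaleC: "bounded_linear (\<lambda>x :: 'a::chilbert_space. a *\<^sub>C x)"
  by (rule bounded_linear_intro[where K = "cmod a"])
    (simp_all add: scaleC_add_right scaleR_scaleC scaleC_scaleC mult.commute norm_scaleC)


section \<open>Bounded operators\<close>

text \<open>Bounded complex-linear operators, as a subtype of the bounded real-linear operators
  of the library, from which they inherit the operator norm.\<close>

typedef (overloaded) 'a bounded_op =
  "{A :: 'a::chilbert_space \<Rightarrow>\<^sub>L 'a. \<forall>c x. blinfun_apply A (c *\<^sub>C x) = c *\<^sub>C blinfun_apply A x}"
  morphisms blinfun_of_op op_of_blinfun
proof
  show "id_blinfun \<in> {A :: 'a \<Rightarrow>\<^sub>L 'a. \<forall>c x. blinfun_apply A (c *\<^sub>C x) = c *\<^sub>C blinfun_apply A x}"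
    by simp
qed

setup_lifting type_definition_bounded_op

lift_definition apply_op :: "'a::chilbert_space bounded_op \<Rightarrow> 'a \<Rightarrow> 'a" is blinfun_apply .

lemma scaleC_zero_right [simp]: "a *\<^sub>C 0 = (0 :: 'a::complex_vector)"
  by (metis add_cancel_right_right scaleC_add_right)

lemma scaleC_minus_right: "a *\<^sub>C (- x) = - (a *\<^sub>C x :: 'a::complex_vector)"
  by (metis add.right_inverse add_eq_0_iff scaleC_add_right scaleC_zero_right)

lemma scaleC_diff_right: "a *\<^sub>C (x - y) = a *\<^sub>C x - (a *\<^sub>C y :: 'a::complex_vector)"
  by (simp add: diff_conv_add_uminus scaleC_add_right scaleC_minus_right del: add_uminus_conv_diff)

instantiation bounded_op :: (chilbert_space) "{real_normed_vector, complex_vector}"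
begin

lift_definition zero_bounded_op :: "'a bounded_op" is 0 by simp
lift_definition plus_bounded_op :: "'a bounded_op \<Rightarrow> 'a bounded_op \<Rightarrow> 'a bounded_op" is "(+)"
  by (simp add: blinfun.add_left scaleC_add_right)
lift_definition minus_bounded_op :: "'a bounded_op \<Rightarrow> 'a bounded_op \<Rightarrow> 'a bounded_op" is "(-)"
  by (simp add: blinfun.diff_left scaleC_diff_right)
lift_definition uminus_bounded_op :: "'a bounded_op \<Rightarrow> 'a bounded_op" is uminus
  by (simp add: blinfun.minus_left scaleC_minus_right)
lift_definition scaleR_bounded_op :: "real \<Rightarrow> 'a bounded_op \<Rightarrow> 'a bounded_op" is scaleR
  by (simp add: blinfun.scaleR_left scaleR_scaleC scaleC_scaleC mult.commute)
lift_definition scaleC_bounded_op :: "complex \<Rightarrow> 'a bounded_op \<Rightarrow> 'a bounded_op"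
  is "\<lambda>c A. Blinfun (\<lambda>x. c *\<^sub>C blinfun_apply A x)"
  by (simp add: bounded_linear_Blinfun_apply scaleC_scaleC mult.commute
      bounded_linear_compose[OF bounded_linear_scaleC blinfun.bounded_linear_right])
lift_definition norm_bounded_op :: "'a bounded_op \<Rightarrow> real" is norm .

definition dist_bounded_op :: "'a bounded_op \<Rightarrow> 'a bounded_op \<Rightarrow> real"
  where "dist_bounded_op A B = norm (A - B)"
definition sgn_bounded_op :: "'a bounded_op \<Rightarrow> 'a bounded_op"
  where "sgn_bounded_op A = scaleR (inverse (norm A)) A"
definition uniformity_bounded_op :: "('a bounded_op \<times> 'a bounded_op) filter"
  where "uniformity_bounded_op = (INF e\<in>{0<..}. principal {(x, y). dist x y < e})"
definition open_bounded_op :: "'a bounded_op set \<Rightarrow> bool"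
  where "open_bounded_op S \<longleftrightarrow>
    (\<forall>x\<in>S. eventually (\<lambda>(x', y). x' = x \<longrightarrow> y \<in> S) uniformity)"

lemma blinfun_scaleC_apply:
  "blinfun_apply (Blinfun (\<lambda>x. c *\<^sub>C blinfun_apply A x)) y
    = c *\<^sub>C (blinfun_apply A y :: 'a)"
  by (simp add: bounded_linear_Blinfun_apply
      bounded_linear_compose[OF bounded_linear_scaleC blinfun.bounded_linear_right])

instance
proof
  fix A B C :: "'a bounded_op" and r s :: real and a b :: complex
  show "A + B + C = A + (B + C)" by transfer simp
  show "A + B = B + A" by transfer simp
  show "0 + A = A" by transfer simp
  show "- A + A = 0" by transfer simp
  show "A - B = A + - B" by transfer simp
  show "r *\<^sub>R (A + B) = r *\<^sub>R A + r *\<^sub>R B" by transfer (simp add: scaleR_add_right)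
  show "(r + s) *\<^sub>R A = r *\<^sub>R A + s *\<^sub>R A" by transfer (simp add: scaleR_add_left)
  show "r *\<^sub>R s *\<^sub>R A = (r * s) *\<^sub>R A" by transfer simp
  show "1 *\<^sub>R A = A" by transfer simp
  show "dist A B = norm (A - B)" by (rule dist_bounded_op_def)
  show "sgn A = scaleR (inverse (norm A)) A" by (rule sgn_bounded_op_def)
  show "(uniformity :: ('a bounded_op \<times> 'a bounded_op) filter)
      = (INF e\<in>{0<..}. principal {(x, y). dist x y < e})"
    by (rule uniformity_bounded_op_def)
  show "open S \<longleftrightarrow> (\<forall>x\<in>S. eventually (\<lambda>(x', y). x' = x \<longrightarrow> y \<in> S) uniformity)"
    for S :: "'a bounded_op set"
    by (rule open_bounded_op_def)
  show "norm A = 0 \<longleftrightarrow> A = 0" by transfer simp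
  show "norm (A + B) \<le> norm A + norm B" by transfer (rule norm_triangle_ineq)
  show "norm (r *\<^sub>R A) = \<bar>r\<bar> * norm A" by transfer simp
  show "a *\<^sub>C (A + B) = a *\<^sub>C A + a *\<^sub>C B"
    by transfer (rule blinfun_eqI, simp only: blinfun_scaleC_apply,
        simp add: blinfun_scaleC_apply blinfun.add_left scaleC_add_right)
  show "(a + b) *\<^sub>C A = a *\<^sub>C A + b *\<^sub>C A"
    by transfer (rule blinfun_eqI, simp only: blinfun_scaleC_apply,
        simp add: blinfun_scaleC_apply blinfun.add_left scaleC_add_left)
  show "a *\<^sub>C b *\<^sub>C A = (a * b) *\<^sub>C A"
    by transfer (rule blinfun_eqI, simp only: blinfun_scaleC_apply,
        simp add: blinfun_scaleC_apply scaleC_scaleC)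
  show "r *\<^sub>R A = complex_of_real r *\<^sub>C A"
    by transfer (rule blinfun_eqI, simp only: blinfun_scaleC_apply,
        simp add: blinfun_scaleC_apply blinfun.scaleR_left scaleR_scaleC)
qed

end

text \<open>Multiplication is composition. The class \<open>real_normed_algebra_1\<close> is not available,
  since \<open>0 = 1\<close> on the zero space.\<close>

instantiation bounded_op :: (chilbert_space) "{real_normed_algebra, monoid_mult}"
begin

lift_definition one_bounded_op :: "'a bounded_op" is id_blinfun by simp
lift_definition times_bounded_op :: "'a bounded_op \<Rightarrow> 'a bounded_op \<Rightarrow> 'a bounded_op" is "(o\<^sub>L)"
  by simp

instance
proof
  fix A B C :: "'a bounded_op" and r :: real
  show "A * B * C = A * (B * C)" by transfer (rule blinfun_eqI, simp)
  show "1 * A = A" by transfer (rule blinfun_eqI, simp)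
  show "A * 1 = A" by transfer (rule blinfun_eqI, simp)
  show "(A + B) * C = A * C + B * C" by transfer (rule bounded_bilinear.add_left[OF bounded_bilinear_blinfun_compose])
  show "A * (B + C) = A * B + A * C" by transfer (rule bounded_bilinear.add_right[OF bounded_bilinear_blinfun_compose])
  show "r *\<^sub>R A * B = r *\<^sub>R (A * B)" by transfer (rule bounded_bilinear.scaleR_left[OF bounded_bilinear_blinfun_compose])
  show "A * r *\<^sub>R B = r *\<^sub>R (A * B)" by transfer (rule bounded_bilinear.scaleR_right[OF bounded_bilinear_blinfun_compose])
  show "norm (A * B) \<le> norm A * norm B" by transfer (rule norm_blinfun_compose)
qed

end

instance bounded_op :: (chilbert_space) banach
proof
  fix X :: "nat \<Rightarrow> 'a bounded_op"
  assume X: "Cauchy X"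
  have dist_eq: "dist (blinfun_of_op A) (blinfun_of_op B) = dist A B" for A B :: "'a bounded_op"
    unfolding dist_norm by transfer simp
  from X have "Cauchy (\<lambda>n. blinfun_of_op (X n))"
    by (simp add: Cauchy_def dist_eq)
  then obtain L where L: "(\<lambda>n. blinfun_of_op (X n)) \<longlonglongrightarrow> L"
    by (meson Cauchy_convergent convergentD)
  have commute: "blinfun_apply (blinfun_of_op A) (c *\<^sub>C x)
      = c *\<^sub>C blinfun_apply (blinfun_of_op A) x" for A :: "'a bounded_op" and c x
    using blinfun_of_op[of A] by simp
  have "blinfun_apply L (c *\<^sub>C x) = c *\<^sub>C blinfun_apply L x" for c x
  proof (rule LIMSEQ_unique)
    have lim: "(\<lambda>n. blinfun_apply (blinfun_of_op (X n)) y) \<longlonglongrightarrow> blinfun_apply L y" for y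
      by (intro tendsto_intros L)
    show "(\<lambda>n. blinfun_apply (blinfun_of_op (X n)) (c *\<^sub>C x)) \<longlonglongrightarrow> blinfun_apply L (c *\<^sub>C x)"
      by (rule lim)
    have "(\<lambda>n. c *\<^sub>C blinfun_apply (blinfun_of_op (X n)) x) \<longlonglongrightarrow> c *\<^sub>C blinfun_apply L x"
      by (rule bounded_linear.tendsto[OF bounded_linear_scaleC lim])
    then show "(\<lambda>n. blinfun_apply (blinfun_of_op (X n)) (c *\<^sub>C x)) \<longlonglongrightarrow> c *\<^sub>C blinfun_apply L x"
      by (simp add: commute)
  qed
  then have "blinfun_of_op (op_of_blinfun L) = L"
    by (simp add: op_of_blinfun_inverse)
  then have "X \<longlonglongrightarrow> op_of_blinfun L"
    using L by (metis (no_types, lifting) dist_eq metric_LIMSEQ_D metric_LIMSEQ_I)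
  then show "convergent X"
    by (rule convergentI)
qed

lemma norm_bounded_op_onorm: "norm A = onorm (apply_op A)"
  by transfer (rule norm_blinfun.rep_eq)

definition hermitian :: "'a::chilbert_space bounded_op \<Rightarrow> bool" where
  "hermitian A \<longleftrightarrow> (\<forall>x y. cinner (apply_op A x) y = cinner x (apply_op A y))"

text \<open>The same series as the library's \<open>exp\<close>, which requires \<open>real_normed_algebra_1\<close>.\<close>

definition op_exp :: "'a::chilbert_space bounded_op \<Rightarrow> 'a bounded_op" where
  "op_exp A = (\<Sum>k. A ^ k /\<^sub>R fact k)"


section \<open>Tensor products\<close>

text \<open>The target space, with the bilinear map \<open>tensor\<close>, is the Hilbert space tensor product of
  the two argument spaces: the completion of the algebraic tensor product with respect to the
  product inner product. The range of \<open>tensor\<close> is closed under complex scaling, so its real span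
  is its complex span.\<close>

definition hilbert_tensor_product ::
  "('s::chilbert_space \<Rightarrow> 'b::chilbert_space \<Rightarrow> 'h::chilbert_space) \<Rightarrow> bool" where
  "hilbert_tensor_product tensor \<longleftrightarrow>
    (\<forall>x x' y. tensor (x + x') y = tensor x y + tensor x' y) \<and>
    (\<forall>x y y'. tensor x (y + y') = tensor x y + tensor x y') \<and>
    (\<forall>c x y. tensor (c *\<^sub>C x) y = c *\<^sub>C tensor x y) \<and>
    (\<forall>c x y. tensor x (c *\<^sub>C y) = c *\<^sub>C tensor x y) \<and>
    (\<forall>x x' y y'. cinner (tensor x y) (tensor x' y') = cinner x x' * cinner y y') \<and>
    closure (span {tensor x y | x y. True}) = UNIV"

text \<open>\<open>is_id_tensor tensor B A\<close> says that \<open>A\<close> is the operator \<open>I \<otimes> B\<close>. Since product vectors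
  span a dense subspace, \<open>A\<close> is determined by \<open>B\<close>.\<close>

definition is_id_tensor ::
  "('s::chilbert_space \<Rightarrow> 'b::chilbert_space \<Rightarrow> 'h::chilbert_space)
    \<Rightarrow> 'b bounded_op \<Rightarrow> 'h bounded_op \<Rightarrow> bool" where
  "is_id_tensor tensor B A \<longleftrightarrow> (\<forall>x y. apply_op A (tensor x y) = tensor x (apply_op B y))"

definition pure_bath ::
  "('s::chilbert_space \<Rightarrow> 'b::chilbert_space \<Rightarrow> 'h::chilbert_space) \<Rightarrow> 'h bounded_op \<Rightarrow> bool" where
  "pure_bath tensor A \<longleftrightarrow> (\<exists>B. is_id_tensor tensor B A)"


section \<open>Time evolution and Magnus terms\<close>

text \<open>One-sided limits are vacuous at \<open>p = a\<close> from the left and at \<open>p = b\<close> from the right.\<close>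

definition piecewise_continuous_on ::
  "real \<Rightarrow> real \<Rightarrow> (real \<Rightarrow> 'a::topological_space) \<Rightarrow> bool" where
  "piecewise_continuous_on a b f \<longleftrightarrow>
    (\<exists>F. finite F \<and> continuous_on ({a..b} - F) f) \<and>
    (\<forall>p\<in>{a..b}. (\<exists>l. (f \<longlongrightarrow> l) (at p within {a..<p})) \<and>
                (\<exists>l. (f \<longlongrightarrow> l) (at p within {p<..b})))"

text \<open>For a piecewise continuous Hamiltonian the Schroedinger equation can only hold away from
  finitely many times; together with continuity it still has exactly one solution.\<close>

definition is_evolution ::
  "(real \<Rightarrow> 'a::chilbert_space bounded_op) \<Rightarrow> real \<Rightarrow> (real \<Rightarrow> 'a bounded_op) \<Rightarrow> bool" where
  "is_evolution H T U \<longleftrightarrow>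
    U 0 = 1 \<and> continuous_on {0..T} U \<and>
    (\<exists>F. finite F \<and> (\<forall>t\<in>{0..T} - F.
      (U has_vector_derivative (- \<i>) *\<^sub>C (H t * U t)) (at t within {0..T})))"

text \<open>Magnus terms are indexed from 1; the value of \<open>\<Omega> 0\<close> is irrelevant. The exponent tends to 0
  with \<open>s\<close>, so it is the principal logarithm of the evolution operator for small \<open>s\<close>, and
  the terms \<open>\<Omega> k\<close>, \<open>k \<ge> 1\<close>, are determined by \<open>H\<close> and \<open>T\<close>.\<close>

definition magnus_terms ::
  "(real \<Rightarrow> 'a::chilbert_space bounded_op) \<Rightarrow> real \<Rightarrow> (nat \<Rightarrow> 'a bounded_op) \<Rightarrow> bool" where
  "magnus_terms H T \<Omega> \<longleftrightarrow>
    (\<exists>r>0. \<forall>s::real. \<bar>s\<bar> < r \<longrightarrow>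
      summable (\<lambda>k. s ^ Suc k *\<^sub>R \<Omega> (Suc k)) \<and>
      (\<exists>U. is_evolution (\<lambda>t. s *\<^sub>R H t) T U \<and>
           U T = op_exp (\<Sum>k. s ^ Suc k *\<^sub>R \<Omega> (Suc k))))"

end

theory Submission
  imports Defs
begin

text \<open>Let \<open>D\<^sub>m\<close> be the \<open>m\<close>-th Dyson term, so that the evolution generated by \<open>s H\<close> is the
  everywhere convergent series \<open>\<Sum> s\<^sup>m D\<^sub>m\<close>. For small \<open>s\<close> it equals \<open>exp (\<Sum> s\<^sup>k \<Omega>\<^sub>k)\<close>, and comparing
  both sides modulo \<open>O(s\<^sup>n\<^sup>+\<^sup>1)\<close> exhibits \<open>D\<^sub>1, \<dots>, D\<^sub>n\<close> as polynomials in \<open>\<Omega>\<^sub>1, \<dots>, \<Omega>\<^sub>n\<close>, hence as pure-bath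
  operators. For \<open>m > n\<close>, replace \<open>D\<^sub>m\<close> by the Dyson term \<open>P\<^sub>m = (-\<i> T H\<^sub>B)\<^sup>m / m!\<close> of \<open>H\<^sub>B\<close> alone, which is
  pure-bath. The difference \<open>D\<^sub>m - P\<^sub>m\<close> collects the words of length \<open>m\<close> that contain \<open>H\<^sub>e\<^sub>r\<^sub>r\<close>, so its norm is
  at most \<open>(\<epsilon>\<^sup>m - \<beta>\<^sup>m) T\<^sup>m / m! \<le> m J \<epsilon>\<^sup>m\<^sup>-\<^sup>1 T\<^sup>m / m!\<close>, the \<open>m\<close>-th summand of the bound. The pure-bath
  approximation is therefore \<open>\<Sum>\<^sub>m\<^sub>\<le>\<^sub>n (D\<^sub>m - P\<^sub>m) + exp (-\<i> T H\<^sub>B)\<close>.\<close>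

section \<open>Integrals of piecewise continuous functions\<close>

text \<open>Induction over a finite set \<open>G\<close> containing the exceptional points interior
  to \<open>{c..d}\<close>; a point of \<open>G\<close> inside the interval splits it. Without such
  points, \<open>f\<close> becomes continuous once its two endpoint values are replaced by one-sided
  limits.\<close>

lemma piecewise_continuous_imp_integrable:
  fixes f :: "real \<Rightarrow> 'a::banach"
  assumes "piecewise_continuous_on a b f"
  shows "f integrable_on {a..b}"
proof -
  obtain F where "finite F" and contF: "continuous_on ({a..b} - F) f"
    using assms unfolding piecewise_continuous_on_def by blast
  have lims: "\<And>p. p \<in> {a..b} \<Longrightarrow>
      (\<exists>l. (f \<longlongrightarrow> l) (at p within {a..<p})) \<and> (\<exists>l. (f \<longlongrightarrow> l) (at p within {p<..b}))"
    using assms unfolding piecewise_continuous_on_def by blast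
  have "f integrable_on {c..d}"
    if "finite G" "a \<le> c" "d \<le> b" "F \<inter> {c<..<d} \<subseteq> G" for G c d
    using that
  proof (induction G arbitrary: c d rule: finite_induct)
    case empty
    show ?case
    proof (cases "c < d")
      case False
      then have "c = d \<or> {c..d} = {}"
        by auto
      then show ?thesis
        using integrable_on_refl[of f c] by auto
    next
      case True
      then have "c \<in> {a..b}" "c < b" "d \<in> {a..b}" "a < d"
        using empty by auto
      then obtain l l' where "(f \<longlongrightarrow> l) (at c within {c<..b})" "(f \<longlongrightarrow> l') (at d within {a..<d})"
        using lims by blast
      \<comment> \<open>The filters omit the point itself and see only nearby points, so the limits
        within \<open>{a..b}\<close> are genuine one-sided limits.\<close>
      moreover have "{c<..b} - {c} = {c..b} - {c}" "{a..<d} - {d} = {a..d} - {d}"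
        by auto
      then have "at c within {c<..b} = at_right c" "at d within {a..<d} = at_left d"
        unfolding at_within_Icc_at_right[OF \<open>c < b\<close>, symmetric] at_within_Icc_at_left[OF \<open>a < d\<close>, symmetric]
        by (simp_all only: at_within_def)
      ultimately have l: "(f \<longlongrightarrow> l) (at_right c)" and l': "(f \<longlongrightarrow> l') (at_left d)"
        by simp_all
      define g where "g x = (if x = c then l else if x = d then l' else f x)" for x
      have "continuous_on {c..d} g"
      proof (rule continuous_on_IccI)
        have "eventually (\<lambda>x. f x = g x) (at_right c)"
          using eventually_at_right_real[OF True] by eventually_elim (auto simp: g_def)
        then show "(g \<longlongrightarrow> g c) (at_right c)"
          using l by (auto simp: g_def intro: Lim_transform_eventually)
        have "eventually (\<lambda>x. f x = g x) (at_left d)"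
          using eventually_at_left_real[OF True] by eventually_elim (auto simp: g_def)
        then show "(g \<longlongrightarrow> g d) (at_left d)"
          using l' True by (auto simp: g_def intro: Lim_transform_eventually)
        fix x assume x: "c < x" "x < d"
        have "continuous_on {c<..<d} f"
          by (rule continuous_on_subset[OF contF]) (use empty in auto)
        then have "f \<midarrow>x\<rightarrow> f x"
          using x by (simp add: continuous_on_eq_continuous_at isCont_def)
        moreover have "eventually (\<lambda>y. f y = g y) (at x)"
        proof -
          have "eventually (\<lambda>y. y \<in> {c<..<d}) (at x)"
            using x by (intro eventually_at_in_open') auto
          then show ?thesis
            by eventually_elim (auto simp: g_def)
        qed
        ultimately show "g \<midarrow>x\<rightarrow> g x"
          using x by (auto simp: g_def intro: Lim_transform_eventually)
      qed (rule True)
      then have "g integrable_on {c..d}"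
        by (rule integrable_continuous_real)
      then show ?thesis
        by (rule integrable_spike_finite[of "{c, d}", rotated 2]) (auto simp: g_def)
    qed
  next
    case (insert x G)
    show ?case
    proof (cases "x \<in> {c<..<d}")
      case False
      then show ?thesis
        using insert by (intro insert.IH) auto
    next
      case True
      then have "f integrable_on {c..x}" "f integrable_on {x..d}"
        using insert.prems by (auto intro!: insert.IH)
      then show ?thesis
        using True by (auto intro: Henstock_Kurzweil_Integration.integrable_combine[of c x d])
    qed
  qed
  from this[OF \<open>finite F\<close>, of a b] show ?thesis
    by simp
qed

lemma piecewise_continuous_on_mult:
  fixes f g :: "real \<Rightarrow> 'a::real_normed_algebra"
  assumes "piecewise_continuous_on a b f" "continuous_on {a..b} g"
  shows "piecewise_continuous_on a b (\<lambda>t. f t * g t)"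
  unfolding piecewise_continuous_on_def
proof (intro conjI ballI)
  obtain F where "finite F" "continuous_on ({a..b} - F) f"
    using assms unfolding piecewise_continuous_on_def by blast
  then show "\<exists>F. finite F \<and> continuous_on ({a..b} - F) (\<lambda>t. f t * g t)"
    using continuous_on_mult continuous_on_subset[OF assms(2) Diff_subset] by blast
  fix p assume p: "p \<in> {a..b}"
  then have g: "(g \<longlongrightarrow> g p) (at p within {a..b})"
    using assms(2) by (auto simp: continuous_on_def)
  have *: "\<exists>l. ((\<lambda>t. f t * g t) \<longlongrightarrow> l) (at p within S)"
    if "\<exists>l. (f \<longlongrightarrow> l) (at p within S)" "S \<subseteq> {a..b}" for S
    using that tendsto_mult tendsto_within_subset[OF g] by blast
  show "\<exists>l. ((\<lambda>t. f t * g t) \<longlongrightarrow> l) (at p within {a..<p})"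
       "\<exists>l. ((\<lambda>t. f t * g t) \<longlongrightarrow> l) (at p within {p<..b})"
    using assms(1) p unfolding piecewise_continuous_on_def by (auto intro!: *)
qed

text \<open>Integrating a monomial bound raises the power by one and divides by
  \<open>Suc k\<close>; repeated along the Dyson recursion, this produces the factorials.\<close>

lemma norm_has_integral_le_power:
  fixes f :: "real \<Rightarrow> 'a::banach"
  assumes "(f has_integral y) {0..t}" "0 \<le> t"
    and "\<And>\<tau>. \<tau> \<in> {0..t} \<Longrightarrow> norm (f \<tau>) \<le> c * \<tau> ^ k"
  shows "norm y \<le> c * t ^ Suc k / Suc k"
proof -
  have "((\<lambda>\<tau>. c * \<tau> ^ k) has_integral (c * t ^ Suc k / Suc k - c * 0 ^ Suc k / Suc k)) {0..t}"
  proof (rule fundamental_theorem_of_calculus[OF \<open>0 \<le> t\<close>])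
    fix x :: real
    have "((\<lambda>x. c * x ^ Suc k / Suc k) has_real_derivative c * x ^ k) (at x within {0..t})"
      by (auto intro!: derivative_eq_intros simp del: power_Suc)
    then show "((\<lambda>x. c * x ^ Suc k / Suc k) has_vector_derivative c * x ^ k) (at x within {0..t})"
      by (simp add: has_real_derivative_iff_has_vector_derivative)
  qed
  then have "((\<lambda>\<tau>. c * \<tau> ^ k) has_integral (c * t ^ Suc k / Suc k)) {0..t}"
    by simp
  then show ?thesis
    using assms integral_norm_bound_integral[of f "{0..t}" "\<lambda>\<tau>. c * \<tau> ^ k"]
    by (auto simp: has_integral_iff)
qed

section \<open>Dyson series\<close>

text \<open>The time-ordered integrals, with the latest factor on the left. The class asks for a
  unit but not for \<open>norm 1 = 1\<close>, which fails for operators on the zero space.\<close>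

primrec dyson :: "(real \<Rightarrow> 'a::{real_normed_algebra, banach, monoid_mult}) \<Rightarrow> nat \<Rightarrow> real \<Rightarrow> 'a"
  where
    "dyson G 0 t = 1"
  | "dyson G (Suc m) t = integral {0..t} (\<lambda>\<tau>. G \<tau> * dyson G m \<tau>)"

text \<open>The two claims feed each other: an integrable integrand makes the next term continuous,
  and a continuous term multiplied by \<open>G\<close> is integrable.\<close>

lemma dyson_integrable_continuous:
  assumes "piecewise_continuous_on 0 T G"
  shows "(\<lambda>\<tau>. G \<tau> * dyson G m \<tau>) integrable_on {0..T} \<and> continuous_on {0..T} (dyson G m)"
proof (induction m)
  case 0
  then show ?case
    using piecewise_continuous_imp_integrable[OF assms] by (simp add: continuous_on_const)
next
  case (Suc m)
  then have "continuous_on {0..T} (dyson G (Suc m))"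
    by (simp add: indefinite_integral_continuous_1)
  then show ?case
    using piecewise_continuous_imp_integrable piecewise_continuous_on_mult[OF assms] by blast
qed

lemma dyson_has_integral:
  assumes "piecewise_continuous_on 0 T G" "t \<in> {0..T}"
  shows "((\<lambda>\<tau>. G \<tau> * dyson G m \<tau>) has_integral dyson G (Suc m) t) {0..t}"
proof -
  have "(\<lambda>\<tau>. G \<tau> * dyson G m \<tau>) integrable_on {0..t}"
    using dyson_integrable_continuous[OF assms(1)] assms(2) integrable_on_subinterval by fastforce
  then show ?thesis
    by (simp add: integrable_integral)
qed

section \<open>The exponential series in a unital normed algebra\<close>

lemma norm_power_le_power_norm:
  fixes x :: "'a::{real_normed_algebra, monoid_mult}"
  assumes "norm (1 :: 'a) \<le> 1"
  shows "norm (x ^ k) \<le> norm x ^ k"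
proof (induction k)
  case (Suc k)
  have "norm (x * x ^ k) \<le> norm x * norm (x ^ k)"
    by (rule norm_mult_ineq)
  also have "\<dots> \<le> norm x * norm x ^ k"
    using Suc by (intro mult_left_mono) auto
  finally show ?case
    by simp
qed (use assms in simp)

lemma summable_exp_series:
  fixes x :: "'a::{real_normed_algebra, banach, monoid_mult}"
  assumes "norm (1 :: 'a) \<le> 1"
  shows "summable (\<lambda>k. x ^ k /\<^sub>R fact k)"
proof (rule summable_comparison_test')
  show "summable (\<lambda>k. norm x ^ k /\<^sub>R fact k)"
    by (rule summable_exp_generic)
  show "norm (x ^ k /\<^sub>R fact k) \<le> norm x ^ k /\<^sub>R fact k" for k
    using norm_power_le_power_norm[OF assms, of x k] by (simp add: mult_left_mono)
qed

text \<open>Each iteration of the integral equation gains one factor \<open>s G\<close>; so any bound on \<open>V\<close> suffices.\<close>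

lemma norm_volterra_minus_dyson_le:
  fixes G V :: "real \<Rightarrow> 'a::{real_normed_algebra, banach, monoid_mult}"
  assumes G: "piecewise_continuous_on 0 T G" "\<And>t. t \<in> {0..T} \<Longrightarrow> norm (G t) \<le> K"
    and V: "\<And>t. t \<in> {0..T} \<Longrightarrow> ((\<lambda>\<tau>. s *\<^sub>R (G \<tau> * V \<tau>)) has_integral V t - 1) {0..t}"
    and M: "\<And>t. t \<in> {0..T} \<Longrightarrow> norm (V t) \<le> M"
    and t: "t \<in> {0..T}"
  shows "norm (V t - (\<Sum>m<N. s ^ m *\<^sub>R dyson G m t)) \<le> M * (\<bar>s\<bar> * K * t) ^ N / fact N"
  using t
proof (induction N arbitrary: t)
  case 0
  then show ?case
    using M by simp
next
  case (Suc N)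
  let ?R = "\<lambda>N \<tau>. V \<tau> - (\<Sum>m<N. s ^ m *\<^sub>R dyson G m \<tau>)"
  have "((\<lambda>\<tau>. s *\<^sub>R (G \<tau> * V \<tau>) - (\<Sum>m<N. s ^ Suc m *\<^sub>R (G \<tau> * dyson G m \<tau>)))
      has_integral (V t - 1) - (\<Sum>m<N. s ^ Suc m *\<^sub>R dyson G (Suc m) t)) {0..t}"
    using Suc.prems by (intro has_integral_diff V has_integral_sum has_integral_cmul
        dyson_has_integral[OF G(1)]) (auto simp del: dyson.simps)
  \<comment> \<open>The \<open>1\<close> in the integral equation is the Dyson term of index 0; the
    shifted terms fill the rest of the next partial sum.\<close>
  moreover have "V t - 1 - (\<Sum>m<N. s ^ Suc m *\<^sub>R dyson G (Suc m) t) = ?R (Suc N) t"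
    by (simp add: sum.lessThan_Suc_shift del: sum.lessThan_Suc)
  moreover have "s *\<^sub>R (G \<tau> * V \<tau>) - (\<Sum>m<N. s ^ Suc m *\<^sub>R (G \<tau> * dyson G m \<tau>))
      = s *\<^sub>R (G \<tau> * ?R N \<tau>)" for \<tau>
    by (simp add: right_diff_distrib scaleR_diff_right sum_distrib_left scaleR_sum_right)
  ultimately have int: "((\<lambda>\<tau>. s *\<^sub>R (G \<tau> * ?R N \<tau>)) has_integral ?R (Suc N) t) {0..t}"
    by (simp only:)
  have K: "0 \<le> K"
    using G(2)[OF Suc.prems] norm_ge_zero order_trans by blast
  have "norm (s *\<^sub>R (G \<tau> * ?R N \<tau>)) \<le> (M * (\<bar>s\<bar> * K) ^ Suc N / fact N) * \<tau> ^ N"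
    if "\<tau> \<in> {0..t}" for \<tau>
  proof -
    have \<tau>: "\<tau> \<in> {0..T}"
      using that Suc.prems by auto
    have "norm (s *\<^sub>R (G \<tau> * ?R N \<tau>)) \<le> \<bar>s\<bar> * (norm (G \<tau>) * norm (?R N \<tau>))"
      by (simp add: mult_left_mono norm_mult_ineq)
    also have "\<dots> \<le> \<bar>s\<bar> * (K * (M * (\<bar>s\<bar> * K * \<tau>) ^ N / fact N))"
      using Suc.IH[OF \<tau>] G(2)[OF \<tau>] K by (intro mult_left_mono mult_mono) auto
    finally show ?thesis
      by (simp add: power_mult_distrib mult_ac)
  qed
  then have "norm (?R (Suc N) t) \<le> (M * (\<bar>s\<bar> * K) ^ Suc N / fact N) * t ^ Suc N / Suc N"
    using Suc.prems by (intro norm_has_integral_le_power[OF int]) auto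
  also have "\<dots> = M * (\<bar>s\<bar> * K * t) ^ Suc N / fact (Suc N)"
    by (simp add: power_mult_distrib mult_ac)
  finally show ?case .
qed

text \<open>Continuity on a compact interval supplies a bound \<open>M\<close> for \<open>V\<close>.
  The remainder is then at most \<open>M\<close> times a term of the exponential series of
  \<open>\<bar>s\<bar> * K * T\<close>, which tends to zero.\<close>

lemma volterra_eq_dyson_series:
  fixes G V :: "real \<Rightarrow> 'a::{real_normed_algebra, banach, monoid_mult}"
  assumes G: "piecewise_continuous_on 0 T G" "\<And>t. t \<in> {0..T} \<Longrightarrow> norm (G t) \<le> K"
    and "continuous_on {0..T} V" "0 \<le> T"
    and V: "\<And>t. t \<in> {0..T} \<Longrightarrow> ((\<lambda>\<tau>. s *\<^sub>R (G \<tau> * V \<tau>)) has_integral V t - 1) {0..t}"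
  shows "(\<lambda>m. s ^ m *\<^sub>R dyson G m T) sums V T"
proof -
  have "bounded (V ` {0..T})"
    using assms by (intro compact_imp_bounded compact_continuous_image) auto
  then obtain M where M: "\<And>t. t \<in> {0..T} \<Longrightarrow> norm (V t) \<le> M"
    unfolding bounded_iff by blast
  have "(\<lambda>N. M * ((\<bar>s\<bar> * K * T) ^ N /\<^sub>R fact N)) \<longlonglongrightarrow> M * 0"
    by (intro tendsto_intros summable_LIMSEQ_zero summable_exp_generic)
  then have "(\<lambda>N. M * (\<bar>s\<bar> * K * T) ^ N / fact N) \<longlonglongrightarrow> 0"
    by (simp add: divide_inverse mult_ac)
  then have "(\<lambda>N. V T - (\<Sum>m<N. s ^ m *\<^sub>R dyson G m T)) \<longlonglongrightarrow> 0"
    by (rule Lim_null_comparison[rotated])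
       (use norm_volterra_minus_dyson_le[OF G V M, of T] \<open>0 \<le> T\<close> in auto)
  then show ?thesis
    unfolding sums_def by (rule Lim_transform2[OF tendsto_const])
qed

text \<open>The subtracted monomial is the \<open>m\<close>-th Dyson term of the constant generator
  \<open>A\<close>. Each recursion step passes the old difference on through \<open>G\<close> and
  creates one new term with \<open>E\<close> in the leftmost place; the factor \<open>m\<close>
  counts the words \<open>G ... G E A ... A\<close> that arise.\<close>

lemma norm_dyson_minus_power_le:
  fixes G E :: "real \<Rightarrow> 'a::{real_normed_algebra, banach, monoid_mult}"
  assumes one: "norm (1 :: 'a) \<le> 1"
    and G: "piecewise_continuous_on 0 T G" "\<And>t. t \<in> {0..T} \<Longrightarrow> G t = A + E t"
    and A: "norm A \<le> \<beta>" and E: "\<And>t. t \<in> {0..T} \<Longrightarrow> norm (E t) \<le> J"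
    and t: "t \<in> {0..T}"
  shows "norm (dyson G m t - (t ^ m / fact m) *\<^sub>R A ^ m) \<le> m * J * (\<beta> + J) ^ (m - 1) * t ^ m / fact m"
  using t
proof (induction m arbitrary: t)
  case (Suc m)
  let ?P = "\<lambda>m t. (t ^ m / fact m) *\<^sub>R A ^ m"
  have J: "0 \<le> J" and \<beta>: "0 \<le> \<beta>"
    using E[OF Suc.prems] A norm_ge_zero order_trans by blast+
  \<comment> \<open>The monomials \<open>?P\<close> satisfy the Dyson recursion with generator
    \<open>A\<close>.\<close>
  have P: "((\<lambda>\<tau>. A * ?P m \<tau>) has_integral ?P (Suc m) t) {0..t}"
  proof -
    have "((\<lambda>\<tau>. A * ?P m \<tau>) has_integral ?P (Suc m) t - ?P (Suc m) 0) {0..t}"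
    proof (rule fundamental_theorem_of_calculus)
      fix x :: real
      have "((\<lambda>t. t ^ Suc m / fact (Suc m)) has_real_derivative (Suc m * x ^ m) / fact (Suc m)) (at x within {0..t})"
        by (auto intro!: derivative_eq_intros simp del: power_Suc fact_Suc)
      moreover have "(Suc m * x ^ m) / fact (Suc m) = x ^ m / fact m"
        by (simp del: of_nat_Suc)
      ultimately have "(?P (Suc m) has_vector_derivative (x ^ m / fact m) *\<^sub>R A ^ Suc m) (at x within {0..t})"
        using has_vector_derivative_scaleR[OF _ has_vector_derivative_const]
        by (fastforce simp del: power_Suc fact_Suc)
      then show "(?P (Suc m) has_vector_derivative A * ?P m x) (at x within {0..t})"
        by simp
    qed (use Suc.prems in auto)
    then show ?thesis
      by simp
  qed
  have int: "((\<lambda>\<tau>. G \<tau> * dyson G m \<tau> - A * ?P m \<tau>) has_integral dyson G (Suc m) t - ?P (Suc m) t) {0..t}"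
    by (intro has_integral_diff P dyson_has_integral[OF G(1) Suc.prems])
  have "norm (G \<tau> * dyson G m \<tau> - A * ?P m \<tau>) \<le> (Suc m * J * (\<beta> + J) ^ m / fact m) * \<tau> ^ m"
    if "\<tau> \<in> {0..t}" for \<tau>
  proof -
    have \<tau>: "\<tau> \<in> {0..T}" "0 \<le> \<tau>"
      using that Suc.prems by auto
    have G\<tau>: "norm (G \<tau>) \<le> \<beta> + J"
      using G(2)[OF \<tau>(1)] A E[OF \<tau>(1)] by (simp add: norm_triangle_mono)
    have "norm (?P m \<tau>) = \<tau> ^ m / fact m * norm (A ^ m)"
      using \<tau> by simp
    also have "\<dots> \<le> \<tau> ^ m / fact m * norm A ^ m"
      using \<tau> by (intro mult_left_mono norm_power_le_power_norm[OF one]) auto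
    \<comment> \<open>Weakening \<open>\<beta>\<close> to \<open>\<beta> + J\<close> brings both
      contributions to the same power.\<close>
    also have "\<dots> \<le> \<tau> ^ m / fact m * (\<beta> + J) ^ m"
      using \<tau> A J by (intro mult_left_mono power_mono) auto
    finally have P\<tau>: "norm (?P m \<tau>) \<le> \<tau> ^ m / fact m * (\<beta> + J) ^ m" .
    have "G \<tau> * dyson G m \<tau> - A * ?P m \<tau> = G \<tau> * (dyson G m \<tau> - ?P m \<tau>) + E \<tau> * ?P m \<tau>"
      using G(2)[OF \<tau>(1)] by (simp add: algebra_simps)
    also have "norm \<dots> \<le> norm (G \<tau>) * norm (dyson G m \<tau> - ?P m \<tau>) + norm (E \<tau>) * norm (?P m \<tau>)"
      by (intro norm_triangle_le add_mono norm_mult_ineq)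
    also have "\<dots> \<le> (\<beta> + J) * (m * J * (\<beta> + J) ^ (m - 1) * \<tau> ^ m / fact m)
        + J * (\<tau> ^ m / fact m * (\<beta> + J) ^ m)"
      using G\<tau> P\<tau> E[OF \<tau>(1)] Suc.IH[OF \<tau>(1)] J \<beta> by (intro add_mono mult_mono) auto
    also have "\<dots> = (Suc m * J * (\<beta> + J) ^ m / fact m) * \<tau> ^ m"
    proof -
      \<comment> \<open>For \<open>m = 0\<close> the truncated exponent \<open>m - 1\<close> does no
        harm, since it comes with the factor \<open>m\<close>.\<close>
      have "z * (m * J * z ^ (m - 1) * \<tau> ^ m / fact m) + J * (\<tau> ^ m / fact m * z ^ m)
          = (Suc m * J * z ^ m / fact m) * \<tau> ^ m" for z :: real
        by (cases m) (simp_all add: field_simps del: fact_Suc)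
      then show ?thesis .
    qed
    finally show ?thesis .
  qed
  then have "norm (dyson G (Suc m) t - ?P (Suc m) t)
      \<le> (Suc m * J * (\<beta> + J) ^ m / fact m) * t ^ Suc m / Suc m"
    using Suc.prems by (intro norm_has_integral_le_power[OF int]) auto
  also have "\<dots> = Suc m * J * (\<beta> + J) ^ (Suc m - 1) * t ^ Suc m / fact (Suc m)"
    by (simp add: field_simps)
  finally show ?case .
qed simp

section \<open>Expansions at zero with coefficients in a subalgebra\<close>

text \<open>The Landau class \<open>O(s ^ n)\<close> as \<open>s\<close> tends to 0. The filter
  \<open>at 0\<close> omits the point itself, so nothing is said about the value there.\<close>

definition small_of_order :: "nat \<Rightarrow> (real \<Rightarrow> 'a::real_normed_vector) \<Rightarrow> bool" where
  "small_of_order n f \<longleftrightarrow> (\<exists>C. \<forall>\<^sub>F s in at 0. norm (f s) \<le> C * \<bar>s\<bar> ^ n)"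

lemma small_of_orderI: "\<forall>\<^sub>F s in at 0. norm (f s) \<le> C * \<bar>s\<bar> ^ n \<Longrightarrow> small_of_order n f"
  unfolding small_of_order_def by blast

lemma small_of_order_zero [simp]: "small_of_order n (\<lambda>s. 0)"
  by (rule small_of_orderI[where C = 0]) simp

lemma small_of_order_cong:
  assumes "small_of_order n f" "\<forall>\<^sub>F s in at 0. f s = g s"
  shows "small_of_order n g"
proof -
  obtain C where "\<forall>\<^sub>F s in at 0. norm (f s) \<le> C * \<bar>s\<bar> ^ n"
    using assms unfolding small_of_order_def by blast
  with assms(2) have "\<forall>\<^sub>F s in at 0. norm (g s) \<le> C * \<bar>s\<bar> ^ n"
    by eventually_elim simp
  then show ?thesis
    by (rule small_of_orderI)
qed

lemma small_of_order_add:
  assumes "small_of_order n f" "small_of_order n g"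
  shows "small_of_order n (\<lambda>s. f s + g s)"
proof -
  obtain C D where "\<forall>\<^sub>F s in at 0. norm (f s) \<le> C * \<bar>s\<bar> ^ n" "\<forall>\<^sub>F s in at 0. norm (g s) \<le> D * \<bar>s\<bar> ^ n"
    using assms unfolding small_of_order_def by blast
  then have "\<forall>\<^sub>F s in at 0. norm (f s + g s) \<le> (C + D) * \<bar>s\<bar> ^ n"
    by eventually_elim (simp add: distrib_right norm_triangle_mono)
  then show ?thesis
    by (rule small_of_orderI)
qed

lemma small_of_order_mult:
  fixes f g :: "real \<Rightarrow> 'a::real_normed_algebra"
  assumes "small_of_order m f" "small_of_order n g"
  shows "small_of_order (m + n) (\<lambda>s. f s * g s)"
proof -
  obtain C D where "\<forall>\<^sub>F s in at 0. norm (f s) \<le> C * \<bar>s\<bar> ^ m" "\<forall>\<^sub>F s in at 0. norm (g s) \<le> D * \<bar>s\<bar> ^ n"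
    using assms unfolding small_of_order_def by blast
  then have "\<forall>\<^sub>F s in at 0. norm (f s * g s) \<le> (C * D) * \<bar>s\<bar> ^ (m + n)"
  proof eventually_elim
    case (elim s)
    have "norm (f s * g s) \<le> norm (f s) * norm (g s)"
      by (rule norm_mult_ineq)
    also have "\<dots> \<le> (C * \<bar>s\<bar> ^ m) * (D * \<bar>s\<bar> ^ n)"
      using elim by (intro mult_mono) (auto intro: order_trans[OF norm_ge_zero])
    finally show ?case
      by (simp add: power_add mult_ac)
  qed
  then show ?thesis
    by (rule small_of_orderI)
qed

lemma small_of_order_scaleR:
  assumes "small_of_order n f"
  shows "small_of_order n (\<lambda>s. c *\<^sub>R f s)"
proof -
  obtain C where "\<forall>\<^sub>F s in at 0. norm (f s) \<le> C * \<bar>s\<bar> ^ n"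
    using assms unfolding small_of_order_def by blast
  then have "\<forall>\<^sub>F s in at 0. norm (c *\<^sub>R f s) \<le> (\<bar>c\<bar> * C) * \<bar>s\<bar> ^ n"
    by eventually_elim (simp add: mult_left_mono mult.assoc)
  then show ?thesis
    by (rule small_of_orderI)
qed

lemma small_of_order_antimono:
  assumes "small_of_order n f" "m \<le> n"
  shows "small_of_order m f"
proof -
  obtain C where C: "\<forall>\<^sub>F s in at 0. norm (f s) \<le> C * \<bar>s\<bar> ^ n"
    using assms unfolding small_of_order_def by blast
  have "\<forall>\<^sub>F s in at (0::real). \<bar>s\<bar> < 1"
    by (auto simp: eventually_at intro!: exI[of _ 1])
  with C have "\<forall>\<^sub>F s in at 0. norm (f s) \<le> \<bar>C\<bar> * \<bar>s\<bar> ^ m"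
  proof eventually_elim
    case (elim s)
    note elim(1)
    also have "C * \<bar>s\<bar> ^ n \<le> \<bar>C\<bar> * \<bar>s\<bar> ^ m"
      using elim assms(2) by (intro mult_mono power_decreasing) auto
    finally show ?case .
  qed
  then show ?thesis
    by (rule small_of_orderI)
qed

lemma small_of_order_power_scaleR: "small_of_order n (\<lambda>s. s ^ n *\<^sub>R c)"
  by (rule small_of_orderI[where C = "norm c"]) (simp add: power_abs mult.commute)

text \<open>Division by \<open>\<bar>s\<bar> ^ k\<close> leaves
  \<open>norm c \<le> C * \<bar>s\<bar>\<close>, whose right-hand side tends to zero.\<close>

lemma small_of_order_monomial_imp_zero:
  assumes "small_of_order (Suc k) (\<lambda>s. s ^ k *\<^sub>R c)"
  shows "c = 0"
proof -
  obtain C where C: "\<forall>\<^sub>F s in at (0::real). norm (s ^ k *\<^sub>R c) \<le> C * \<bar>s\<bar> ^ Suc k"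
    using assms unfolding small_of_order_def by blast
  have "\<forall>\<^sub>F s in at (0::real). s \<noteq> 0"
    by (simp add: eventually_at_filter)
  with C have "\<forall>\<^sub>F s in at (0::real). norm c \<le> C * \<bar>s\<bar>"
  proof eventually_elim
    case (elim s)
    then have "\<bar>s\<bar> ^ k * norm c \<le> \<bar>s\<bar> ^ k * (C * \<bar>s\<bar>)"
      by (simp add: power_abs mult_ac)
    then show ?case
      using elim(2) by (simp add: mult_le_cancel_left)
  qed
  moreover have "((\<lambda>s::real. C * \<bar>s\<bar>) \<longlongrightarrow> C * \<bar>0\<bar>) (at 0)"
    by (intro tendsto_intros)
  ultimately have "norm c \<le> C * \<bar>0\<bar>"
    by (intro tendsto_lowerbound) auto
  then show ?thesis
    by simp
qed

lemma small_of_order_sum: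
  assumes "\<And>i. i \<in> I \<Longrightarrow> small_of_order n (f i)"
  shows "small_of_order n (\<lambda>s. \<Sum>i\<in>I. f i s)"
  using assms
  by (induction I rule: infinite_finite_induct) (auto intro!: small_of_order_add)

text \<open>The coefficients vanish successively from the lowest degree: once those below
  \<open>k\<close> are zero and the higher monomials are moved into the error, the term of degree
  \<open>k\<close> is of order \<open>Suc k\<close>.\<close>

lemma small_of_order_polynomial_imp_zero:
  fixes c :: "nat \<Rightarrow> 'a::real_normed_vector"
  assumes small: "small_of_order (Suc n) (\<lambda>s. \<Sum>k\<le>n. s ^ k *\<^sub>R c k)" and "k \<le> n"
  shows "c k = 0"
  using \<open>k \<le> n\<close>
proof (induction k rule: less_induct)
  case (less k)
  have "small_of_order (Suc k) (\<lambda>s. \<Sum>i\<in>{k<..n}. s ^ i *\<^sub>R c i)"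
    by (intro small_of_order_sum small_of_order_antimono[OF small_of_order_power_scaleR]) auto
  from small_of_order_add[OF small_of_order_antimono[OF small] small_of_order_scaleR[OF this, of "-1"]]
  have *: "small_of_order (Suc k) (\<lambda>s. (\<Sum>i\<le>n. s ^ i *\<^sub>R c i) - (\<Sum>i\<in>{k<..n}. s ^ i *\<^sub>R c i))"
    using less.prems by simp
  have "(\<Sum>i\<le>n. s ^ i *\<^sub>R c i) - (\<Sum>i\<in>{k<..n}. s ^ i *\<^sub>R c i) = s ^ k *\<^sub>R c k" for s :: real
  proof -
    have "{..n} = {..<k} \<union> {k} \<union> {k<..n}"
      using less.prems by auto
    then have "(\<Sum>i\<le>n. s ^ i *\<^sub>R c i)
        = (\<Sum>i<k. s ^ i *\<^sub>R c i) + s ^ k *\<^sub>R c k + (\<Sum>i\<in>{k<..n}. s ^ i *\<^sub>R c i)"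
      by (simp only:) (subst sum.union_disjoint; auto)+
    moreover have "(\<Sum>i<k. s ^ i *\<^sub>R c i) = 0"
      using less by (intro sum.neutral) auto
    ultimately show ?thesis
      by simp
  qed
  with * show ?case
    using small_of_order_monomial_imp_zero by simp
qed

text \<open>Convergence at \<open>2 * d\<close> bounds \<open>norm (a k)\<close> by
  \<open>M / (2 * d) ^ k\<close>. For \<open>\<bar>s\<bar> \<le> d\<close>, factoring out
  \<open>\<bar>s\<bar> ^ n\<close> leaves a tail dominated by a geometric series of ratio
  1/2.\<close>

lemma small_of_order_powser_tail:
  fixes a :: "nat \<Rightarrow> 'a::banach"
  assumes "r > 0" and sum: "\<And>s::real. \<bar>s\<bar> < r \<Longrightarrow> summable (\<lambda>k. s ^ k *\<^sub>R a k)"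
  shows "small_of_order n (\<lambda>s. (\<Sum>k. s ^ k *\<^sub>R a k) - (\<Sum>k<n. s ^ k *\<^sub>R a k))"
proof -
  \<comment> \<open>The quarter keeps \<open>2 * d\<close> inside the range where the series is
    summable.\<close>
  define d where "d = r / 4"
  have "d > 0" "\<bar>2 * d\<bar> < r"
    using \<open>r > 0\<close> by (auto simp: d_def)
  have "Bseq (\<lambda>k. (2 * d) ^ k *\<^sub>R a k)"
    using sum[OF \<open>\<bar>2 * d\<bar> < r\<close>] summable_LIMSEQ_zero convergentI convergent_imp_Bseq by blast
  then obtain M where M: "\<And>k. norm ((2 * d) ^ k *\<^sub>R a k) \<le> M"
    by (auto simp: Bseq_def)
  have "0 \<le> M"
    using M[of 0] norm_ge_zero order_trans by blast
  define g where "g k = M * (1/2) ^ k / d ^ n" for k :: nat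
  have "summable g"
    unfolding g_def by (intro summable_divide summable_mult summable_geometric) auto
  have "norm ((\<Sum>k. s ^ k *\<^sub>R a k) - (\<Sum>k<n. s ^ k *\<^sub>R a k)) \<le> suminf g * \<bar>s\<bar> ^ n"
    if "\<bar>s\<bar> \<le> d" for s
  proof -
    have s: "\<bar>s\<bar> < r"
      using that \<open>d > 0\<close> \<open>\<bar>2 * d\<bar> < r\<close> by auto
    have "norm (s ^ (k + n) *\<^sub>R a (k + n)) \<le> g k * \<bar>s\<bar> ^ n" for k
    proof -
      have "norm (a (k + n)) \<le> M / (2 * d) ^ (k + n)"
        using M[of "k + n"] \<open>d > 0\<close> by (simp add: field_simps)
      \<comment> \<open>Of \<open>2 ^ (k + n)\<close> only \<open>2 ^ k\<close> is kept, which
        already makes \<open>g\<close> summable.\<close>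
      also have "\<dots> \<le> M / (2 ^ k * d ^ (k + n))"
        using \<open>0 \<le> M\<close> \<open>d > 0\<close>
        by (auto simp: power_mult_distrib power_add intro!: divide_left_mono)
      finally have "norm (s ^ (k + n) *\<^sub>R a (k + n)) \<le> \<bar>s\<bar> ^ k * \<bar>s\<bar> ^ n * (M / (2 ^ k * d ^ (k + n)))"
        unfolding norm_scaleR abs_mult power_abs power_add[of s] by (intro mult_left_mono) auto
      also have "\<dots> \<le> d ^ k * \<bar>s\<bar> ^ n * (M / (2 ^ k * d ^ (k + n)))"
        using that \<open>0 \<le> M\<close> \<open>d > 0\<close> by (intro mult_right_mono power_mono) auto
      also have "\<dots> = g k * \<bar>s\<bar> ^ n"
        using \<open>d > 0\<close> by (simp add: g_def power_add field_simps)
      finally show ?thesis .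
    qed
    then have "norm (\<Sum>k. s ^ (k + n) *\<^sub>R a (k + n)) \<le> (\<Sum>k. g k * \<bar>s\<bar> ^ n)"
      using \<open>summable g\<close> by (intro norm_suminf_le summable_mult2) auto
    then show ?thesis
      using suminf_minus_initial_segment[OF sum[OF s], of n] suminf_mult2[OF \<open>summable g\<close>] by simp
  qed
  then have "\<forall>\<^sub>F s in at 0. norm ((\<Sum>k. s ^ k *\<^sub>R a k) - (\<Sum>k<n. s ^ k *\<^sub>R a k)) \<le> suminf g * \<bar>s\<bar> ^ n"
    using \<open>d > 0\<close> by (auto simp: eventually_at intro!: exI[of _ d])
  then show ?thesis
    by (rule small_of_orderI)
qed

text \<open>A Taylor polynomial of degree \<open>n\<close> at 0 with coefficients in
  \<open>V\<close>, up to \<open>O(s ^ (n + 1))\<close>. Only an asymptotic expansion is demanded,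
  no derivatives.\<close>

definition has_jet_in :: "'a::real_normed_vector set \<Rightarrow> nat \<Rightarrow> (real \<Rightarrow> 'a) \<Rightarrow> bool" where
  "has_jet_in V n f \<longleftrightarrow> (\<exists>q. (\<forall>k\<le>n. q k \<in> V) \<and> small_of_order (Suc n) (\<lambda>s. f s - (\<Sum>k\<le>n. s ^ k *\<^sub>R q k)))"

lemma has_jet_in_add:
  assumes "subspace V" "has_jet_in V n f" "has_jet_in V n g"
  shows "has_jet_in V n (\<lambda>s. f s + g s)"
proof -
  obtain p q where "\<forall>k\<le>n. p k \<in> V" "\<forall>k\<le>n. q k \<in> V"
    and pq: "small_of_order (Suc n) (\<lambda>s. f s - (\<Sum>k\<le>n. s ^ k *\<^sub>R p k))"
      "small_of_order (Suc n) (\<lambda>s. g s - (\<Sum>k\<le>n. s ^ k *\<^sub>R q k))"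
    using assms unfolding has_jet_in_def by blast
  then show ?thesis
    using small_of_order_add[OF pq] subspace_add[OF assms(1)] unfolding has_jet_in_def
    by (auto intro!: exI[of _ "\<lambda>k. p k + q k"] simp: scaleR_add_right sum.distrib algebra_simps)
qed

lemma has_jet_in_small:
  assumes "subspace V" "small_of_order (Suc n) f"
  shows "has_jet_in V n f"
  using assms subspace_0 unfolding has_jet_in_def by (auto intro!: exI[of _ "\<lambda>k. 0"])

text \<open>Beyond degree \<open>n\<close> the monomial is itself remainder, so a product of Taylor
  polynomials needs no separate truncation.\<close>

lemma has_jet_in_monomial:
  assumes "subspace V" "c \<in> V"
  shows "has_jet_in V n (\<lambda>s. s ^ i *\<^sub>R c)"
proof (cases "i \<le> n")
  case True
  have "(\<Sum>k\<le>n. s ^ k *\<^sub>R (if k = i then c else 0)) = s ^ i *\<^sub>R c" for s :: real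
    using True by (simp add: if_distrib[of "\<lambda>x. _ *\<^sub>R x"] cong: if_cong)
  then show ?thesis
    using assms subspace_0 unfolding has_jet_in_def
    by (auto intro!: exI[of _ "\<lambda>k. if k = i then c else 0"])
next
  case False
  then show ?thesis
    using assms(1) by (intro has_jet_in_small small_of_order_antimono[OF small_of_order_power_scaleR]) auto
qed

lemma has_jet_in_sum:
  assumes "subspace V" "\<And>i. i \<in> I \<Longrightarrow> has_jet_in V n (f i)"
  shows "has_jet_in V n (\<lambda>s. \<Sum>i\<in>I. f i s)"
  using assms(2)
  by (induction I rule: infinite_finite_induct)
     (simp_all add: has_jet_in_add has_jet_in_small assms(1))

lemma has_jet_in_scaleR:
  assumes "subspace V" "has_jet_in V n f"
  shows "has_jet_in V n (\<lambda>s. c *\<^sub>R f s)"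
proof -
  obtain p where "\<forall>k\<le>n. p k \<in> V"
    and p: "small_of_order (Suc n) (\<lambda>s. f s - (\<Sum>k\<le>n. s ^ k *\<^sub>R p k))"
    using assms unfolding has_jet_in_def by blast
  then show ?thesis
    using small_of_order_scaleR[OF p, of c] subspace_scale[OF assms(1)] unfolding has_jet_in_def
    by (auto intro!: exI[of _ "\<lambda>k. c *\<^sub>R p k"] simp: scaleR_diff_right scaleR_sum_right mult.commute)
qed

lemma has_jet_in_cong:
  assumes "has_jet_in V n f" "\<forall>\<^sub>F s in at 0. f s = g s"
  shows "has_jet_in V n g"
proof -
  obtain p where p: "\<forall>k\<le>n. p k \<in> V" "small_of_order (Suc n) (\<lambda>s. f s - (\<Sum>k\<le>n. s ^ k *\<^sub>R p k))"
    using assms unfolding has_jet_in_def by blast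
  have "small_of_order (Suc n) (\<lambda>s. g s - (\<Sum>k\<le>n. s ^ k *\<^sub>R p k))"
    by (rule small_of_order_cong[OF p(2)]) (use assms(2) in eventually_elim, simp)
  then show ?thesis
    using p(1) unfolding has_jet_in_def by blast
qed

text \<open>Order 0 is boundedness near 0. Multiplication by a factor of this order keeps a
  remainder at its order.\<close>

lemma small_of_order_0_polynomial: "small_of_order 0 (\<lambda>s. \<Sum>k\<le>n. s ^ k *\<^sub>R p k)"
proof (induction n)
  case 0
  then show ?case using small_of_order_power_scaleR[of 0 "p 0"] by simp
next
  case (Suc n)
  then show ?case
    using small_of_order_antimono[OF small_of_order_power_scaleR[of "Suc n" "p (Suc n)"]]
    by (auto intro: small_of_order_add)
qed

text \<open>With Taylor polynomials \<open>?P\<close> and \<open>?Q\<close>, the product is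
  \<open>?P ?Q + (f - ?P) g + ?P (g - ?Q)\<close>. The first summand has coefficients in
  \<open>V\<close> by closure under multiplication; the others are of order \<open>Suc n\<close>
  because \<open>g\<close> and \<open>?P\<close> stay bounded.\<close>

lemma has_jet_in_mult:
  fixes f g :: "real \<Rightarrow> 'a::real_normed_algebra"
  assumes V: "subspace V" "\<And>a b. a \<in> V \<Longrightarrow> b \<in> V \<Longrightarrow> a * b \<in> V"
    and "has_jet_in V n f" "has_jet_in V n g"
  shows "has_jet_in V n (\<lambda>s. f s * g s)"
proof -
  obtain p q where pV: "\<forall>k\<le>n. p k \<in> V" and qV: "\<forall>k\<le>n. q k \<in> V"
    and p: "small_of_order (Suc n) (\<lambda>s. f s - (\<Sum>k\<le>n. s ^ k *\<^sub>R p k))"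
    and q: "small_of_order (Suc n) (\<lambda>s. g s - (\<Sum>k\<le>n. s ^ k *\<^sub>R q k))"
    using assms unfolding has_jet_in_def by blast
  let ?P = "\<lambda>s. \<Sum>k\<le>n. s ^ k *\<^sub>R p k" and ?Q = "\<lambda>s. \<Sum>k\<le>n. s ^ k *\<^sub>R q k"
  have "has_jet_in V n (\<lambda>s. \<Sum>i\<le>n. \<Sum>j\<le>n. s ^ (i + j) *\<^sub>R (p i * q j))"
    using pV qV V by (intro has_jet_in_sum has_jet_in_monomial) auto
  then have PQ: "has_jet_in V n (\<lambda>s. ?P s * ?Q s)"
    by (simp add: sum_product power_add mult.commute)
  have g: "small_of_order 0 g"
    using small_of_order_add[OF small_of_order_antimono[OF q] small_of_order_0_polynomial[of q n]]
    by simp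
  have "small_of_order (Suc n) (\<lambda>s. (f s - ?P s) * g s)"
    using small_of_order_mult[OF p g] by simp
  moreover have "small_of_order (Suc n) (\<lambda>s. ?P s * (g s - ?Q s))"
    using small_of_order_mult[OF small_of_order_0_polynomial q] by simp
  ultimately have "has_jet_in V n (\<lambda>s. ?P s * ?Q s + ((f s - ?P s) * g s + ?P s * (g s - ?Q s)))"
    by (intro has_jet_in_add has_jet_in_small PQ small_of_order_add V)
  then show ?thesis
    by (simp add: algebra_simps)
qed

lemma has_jet_in_power:
  fixes f :: "real \<Rightarrow> 'a::{real_normed_algebra, monoid_mult}"
  assumes V: "subspace V" "1 \<in> V" "\<And>a b. a \<in> V \<Longrightarrow> b \<in> V \<Longrightarrow> a * b \<in> V"
    and "has_jet_in V n f"
  shows "has_jet_in V n (\<lambda>s. f s ^ j)"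
proof (induction j)
  case 0
  then show ?case
    using has_jet_in_monomial[OF V(1,2), of n 0] by simp
next
  case (Suc j)
  then show ?case
    using has_jet_in_mult[OF V(1,3) assms(4)] by simp
qed

section \<open>Jets of power series and of the exponential\<close>

lemma has_jet_in_powser:
  fixes a :: "nat \<Rightarrow> 'a::banach"
  assumes "r > 0" "\<And>s::real. \<bar>s\<bar> < r \<Longrightarrow> summable (\<lambda>k. s ^ k *\<^sub>R a k)" "\<And>k. k \<le> n \<Longrightarrow> a k \<in> V"
  shows "has_jet_in V n (\<lambda>s. \<Sum>k. s ^ k *\<^sub>R a k)"
  using small_of_order_powser_tail[OF assms(1,2), of "Suc n"] assms(3)
  unfolding has_jet_in_def lessThan_Suc_atMost by auto

text \<open>Taylor coefficients are unique: the partial sum and the polynomial of the jet differ by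
  a polynomial of degree at most \<open>n\<close> that is of order \<open>Suc n\<close>, hence has
  zero coefficients.\<close>

lemma powser_coeff_in_of_has_jet_in:
  fixes a :: "nat \<Rightarrow> 'a::banach"
  assumes "r > 0" "\<And>s::real. \<bar>s\<bar> < r \<Longrightarrow> summable (\<lambda>k. s ^ k *\<^sub>R a k)"
    and jet: "has_jet_in V n (\<lambda>s. \<Sum>k. s ^ k *\<^sub>R a k)" and "k \<le> n"
  shows "a k \<in> V"
proof -
  obtain q where qV: "\<forall>k\<le>n. q k \<in> V"
    and q: "small_of_order (Suc n) (\<lambda>s. (\<Sum>k. s ^ k *\<^sub>R a k) - (\<Sum>k\<le>n. s ^ k *\<^sub>R q k))"
    using jet unfolding has_jet_in_def by blast
  have "small_of_order (Suc n) (\<lambda>s. \<Sum>k\<le>n. s ^ k *\<^sub>R (q k - a k))"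
    using small_of_order_add[OF small_of_order_powser_tail[OF assms(1,2), of "Suc n"]
        small_of_order_scaleR[OF q, of "-1"]]
    unfolding lessThan_Suc_atMost by (simp add: scaleR_diff_right sum_subtractf)
  from small_of_order_polynomial_imp_zero[OF this \<open>k \<le> n\<close>] show ?thesis
    using qV \<open>k \<le> n\<close> by (metis eq_iff_diff_eq_0)
qed

text \<open>Lowering the denominator to \<open>fact k\<close> and using
  \<open>norm x ^ k \<le> 1\<close> leaves \<open>norm x ^ n\<close> times the series of
  \<open>exp 1\<close>.\<close>

lemma exp_series_tail_le:
  fixes x :: "'a::{real_normed_algebra, banach, monoid_mult}"
  assumes one: "norm (1 :: 'a) \<le> 1" and "norm x \<le> 1"
  shows "norm ((\<Sum>k. x ^ k /\<^sub>R fact k) - (\<Sum>k<n. x ^ k /\<^sub>R fact k)) \<le> exp 1 * norm x ^ n"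
proof -
  have bound: "norm (x ^ (k + n) /\<^sub>R fact (k + n)) \<le> 1 /\<^sub>R fact k * norm x ^ n" for k n
  proof -
    have "norm (x ^ (k + n)) \<le> norm x ^ k * norm x ^ n"
      using norm_power_le_power_norm[OF one] by (simp flip: power_add)
    also have "\<dots> \<le> 1 * norm x ^ n"
      using \<open>norm x \<le> 1\<close> by (intro mult_right_mono power_le_one) auto
    finally have "norm (x ^ (k + n)) \<le> norm x ^ n"
      by simp
    then have "norm (x ^ (k + n)) / fact (k + n) \<le> norm x ^ n / fact k"
      by (intro frac_le) (auto simp: fact_mono)
    then show ?thesis
      by (simp add: divide_inverse mult.commute)
  qed
  have exp1: "(\<lambda>k. 1 /\<^sub>R fact k) sums exp (1::real)"
    using exp_converges[of "1::real"] by simp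
  have "(\<Sum>k. x ^ k /\<^sub>R fact k) - (\<Sum>k<n. x ^ k /\<^sub>R fact k) = (\<Sum>k. x ^ (k + n) /\<^sub>R fact (k + n))"
    by (rule suminf_minus_initial_segment[OF summable_exp_series[OF one], symmetric])
  also have "norm \<dots> \<le> (\<Sum>k. 1 /\<^sub>R fact k * norm x ^ n)"
    using bound exp1 by (intro norm_suminf_le summable_mult2) (auto simp: sums_iff)
  also have "\<dots> = exp 1 * norm x ^ n"
    using sums_mult2[OF exp1, of "norm x ^ n"] by (simp add: sums_iff)
  finally show "norm ((\<Sum>k. x ^ k /\<^sub>R fact k) - (\<Sum>k<n. x ^ k /\<^sub>R fact k)) \<le> exp 1 * norm x ^ n" .
qed

text \<open>Since \<open>f\<close> is of order 1, the terms beyond the \<open>n\<close>-th power sum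
  to order \<open>Suc n\<close>. What remains is a polynomial in \<open>f\<close>, so no limit is
  taken inside \<open>V\<close>.\<close>

lemma has_jet_in_exp_series:
  fixes f :: "real \<Rightarrow> 'a::{real_normed_algebra, banach, monoid_mult}"
  assumes one: "norm (1 :: 'a) \<le> 1"
    and V: "subspace V" "1 \<in> V" "\<And>a b. a \<in> V \<Longrightarrow> b \<in> V \<Longrightarrow> a * b \<in> V"
    and jet: "has_jet_in V n f" and small: "small_of_order 1 f"
  shows "has_jet_in V n (\<lambda>s. \<Sum>k. f s ^ k /\<^sub>R fact k)"
proof -
  obtain C where C: "\<forall>\<^sub>F s in at 0. norm (f s) \<le> C * \<bar>s\<bar>"
    using small unfolding small_of_order_def by auto
  have "((\<lambda>s::real. C * \<bar>s\<bar>) \<longlongrightarrow> C * \<bar>0\<bar>) (at 0)"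
    by (intro tendsto_intros)
  then have "\<forall>\<^sub>F s in at 0. C * \<bar>s\<bar> < 1"
    by (rule order_tendstoD) simp
  with C have "\<forall>\<^sub>F s in at 0. norm ((\<Sum>k. f s ^ k /\<^sub>R fact k) - (\<Sum>k<Suc n. f s ^ k /\<^sub>R fact k))
      \<le> (exp 1 * C ^ Suc n) * \<bar>s\<bar> ^ Suc n"
  proof eventually_elim
    case (elim s)
    have "norm ((\<Sum>k. f s ^ k /\<^sub>R fact k) - (\<Sum>k<Suc n. f s ^ k /\<^sub>R fact k)) \<le> exp 1 * norm (f s) ^ Suc n"
      by (rule exp_series_tail_le[OF one]) (use elim in linarith)
    also have "\<dots> \<le> exp 1 * (C * \<bar>s\<bar>) ^ Suc n"
      using elim(1) by (intro mult_left_mono power_mono) auto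
    finally show ?case
      by (simp only: power_mult_distrib mult.assoc)
  qed
  then have tail: "small_of_order (Suc n)
      (\<lambda>s. (\<Sum>k. f s ^ k /\<^sub>R fact k) - (\<Sum>k<Suc n. f s ^ k /\<^sub>R fact k))"
    by (rule small_of_orderI)
  have "has_jet_in V n (\<lambda>s. \<Sum>k<Suc n. f s ^ k /\<^sub>R fact k)"
    by (intro has_jet_in_sum has_jet_in_scaleR has_jet_in_power V jet)
  from has_jet_in_add[OF V(1) this has_jet_in_small[OF V(1) tail]] show ?thesis
    by simp
qed

text \<open>Carries membership in \<open>V\<close> from the Magnus terms to the Dyson terms: the
  exponent has a jet in \<open>V\<close>, hence so has its exponential, and uniqueness of the
  expansion identifies the coefficients \<open>a k\<close> with those of this jet.\<close>

lemma powser_coeff_in_of_exp_powser: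
  fixes a \<Omega> :: "nat \<Rightarrow> 'a::{real_normed_algebra, banach, monoid_mult}"
  assumes one: "norm (1 :: 'a) \<le> 1"
    and V: "subspace V" "1 \<in> V" "\<And>a b. a \<in> V \<Longrightarrow> b \<in> V \<Longrightarrow> a * b \<in> V"
    and "r > 0"
    and \<Omega>: "\<And>s::real. \<bar>s\<bar> < r \<Longrightarrow> summable (\<lambda>k. s ^ Suc k *\<^sub>R \<Omega> (Suc k))"
    and a: "\<And>s::real. \<bar>s\<bar> < r \<Longrightarrow>
      (\<lambda>k. s ^ k *\<^sub>R a k) sums (\<Sum>j. (\<Sum>k. s ^ Suc k *\<^sub>R \<Omega> (Suc k)) ^ j /\<^sub>R fact j)"
    and \<Omega>V: "\<And>k. k \<in> {1..n} \<Longrightarrow> \<Omega> k \<in> V" and "k \<le> n"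
  shows "a k \<in> V"
proof -
  \<comment> \<open>Padding with 0 at index 0 makes the exponent a power series without constant
    term, hence of order 1.\<close>
  define w where "w k = (if k = 0 then 0 else \<Omega> k)" for k
  have w: "summable (\<lambda>k. s ^ k *\<^sub>R w k)" if "\<bar>s\<bar> < r" for s
    using \<Omega>[OF that] by (subst summable_Suc_iff[symmetric]) (simp add: w_def)
  have w_eq: "(\<Sum>k. s ^ k *\<^sub>R w k) = (\<Sum>k. s ^ Suc k *\<^sub>R \<Omega> (Suc k))" if "\<bar>s\<bar> < r" for s
    using suminf_split_head[OF w[OF that]] by (simp add: w_def)
  have "has_jet_in V n (\<lambda>s. \<Sum>k. s ^ k *\<^sub>R w k)"
    using \<Omega>V subspace_0[OF V(1)] by (intro has_jet_in_powser[OF \<open>r > 0\<close> w]) (auto simp: w_def)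
  moreover have "small_of_order 1 (\<lambda>s. \<Sum>k. s ^ k *\<^sub>R w k)"
    using small_of_order_powser_tail[OF \<open>r > 0\<close> w, of 1] by (simp add: w_def)
  ultimately have "has_jet_in V n (\<lambda>s. \<Sum>j. (\<Sum>k. s ^ k *\<^sub>R w k) ^ j /\<^sub>R fact j)"
    by (intro has_jet_in_exp_series one V)
  moreover have "\<forall>\<^sub>F s in at 0. (\<Sum>j. (\<Sum>k. s ^ k *\<^sub>R w k) ^ j /\<^sub>R fact j) = (\<Sum>k. s ^ k *\<^sub>R a k)"
    using \<open>r > 0\<close> a w_eq by (auto simp: eventually_at sums_iff intro!: exI[of _ r])
  ultimately have "has_jet_in V n (\<lambda>s. \<Sum>k. s ^ k *\<^sub>R a k)"
    by (rule has_jet_in_cong)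
  then show ?thesis
    using a by (intro powser_coeff_in_of_has_jet_in[OF \<open>r > 0\<close> _ _ \<open>k \<le> n\<close>]) (auto simp: sums_iff)
qed

section \<open>Operators and pure-bath operators\<close>

lemma apply_op_simps [simp]:
  "apply_op 0 x = 0" "apply_op 1 x = x"
  "apply_op (A + B) x = apply_op A x + apply_op B x"
  "apply_op (r *\<^sub>R A) x = r *\<^sub>R apply_op A x"
  "apply_op (c *\<^sub>C A) x = c *\<^sub>C apply_op A x"
  "apply_op (A * B) x = apply_op A (apply_op B x)"
  by (transfer; simp add: blinfun.add_left blinfun.scaleR_left blinfun_scaleC_apply)+

lemma norm_apply_op_le: "norm (apply_op A x) \<le> norm A * norm x"
  by transfer (rule norm_blinfun)

lemma bounded_linear_apply_op: "bounded_linear (\<lambda>A. apply_op A x)"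
  by (rule bounded_linear_intro[where K = "norm x"]) (simp_all add: norm_apply_op_le)

lemma norm_one_bounded_op_le: "norm (1 :: 'a::chilbert_space bounded_op) \<le> 1"
  by transfer (rule norm_blinfun_id_le)

lemma norm_scaleC_bounded_op_le: "norm (c *\<^sub>C A) \<le> cmod c * norm (A :: 'a::chilbert_space bounded_op)"
proof (transfer fixing: c)
  fix A :: "'a \<Rightarrow>\<^sub>L 'a"
  show "norm (Blinfun (\<lambda>x. c *\<^sub>C blinfun_apply A x)) \<le> cmod c * norm A"
    by (rule norm_blinfun_bound)
      (auto simp: blinfun_scaleC_apply norm_scaleC mult.assoc intro!: mult_left_mono norm_blinfun)
qed

lemma scaleC_scaleR_commute: "c *\<^sub>C (r *\<^sub>R x) = r *\<^sub>R c *\<^sub>C (x :: 'a::complex_vector)"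
  by (simp add: scaleR_scaleC scaleC_scaleC mult.commute)

lemma bounded_op_eqI: "(\<And>x. apply_op A x = apply_op B x) \<Longrightarrow> A = B"
  by transfer (rule blinfun_eqI)

lemma scaleC_mult_left: "(c *\<^sub>C A) * B = c *\<^sub>C (A * B :: 'a::chilbert_space bounded_op)"
  by (rule bounded_op_eqI) simp

lemma bounded_linear_scaleC_bounded_op:
  "bounded_linear (\<lambda>A :: 'a::chilbert_space bounded_op. c *\<^sub>C A)"
  by (rule bounded_linear_intro[where K = "cmod c"])
    (simp_all add: scaleC_add_right scaleC_scaleR_commute norm_scaleC_bounded_op_le mult.commute)

lemma power_scaleR_monoid:
  fixes x :: "'a::{real_normed_algebra, monoid_mult}"
  shows "(r *\<^sub>R x) ^ k = r ^ k *\<^sub>R x ^ k"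
  by (induction k) (simp_all add: mult.commute)

lemma op_exp_sums: "(\<lambda>k. A ^ k /\<^sub>R fact k) sums op_exp A"
  unfolding op_exp_def by (intro summable_sums summable_exp_series norm_one_bounded_op_le)

section \<open>Operators of the form I \<otimes> B\<close>

context
  fixes tensor :: "'s::chilbert_space \<Rightarrow> 'b::chilbert_space \<Rightarrow> 'h::chilbert_space"
  assumes tensor: "hilbert_tensor_product tensor"
begin

lemma tensor_add_right: "tensor x (y + y') = tensor x y + tensor x y'"
  and tensor_scaleC_right: "tensor x (c *\<^sub>C y) = c *\<^sub>C tensor x y"
  using tensor unfolding hilbert_tensor_product_def by blast+

lemma tensor_scaleR_right: "tensor x (r *\<^sub>R y) = r *\<^sub>R tensor x y"
  by (simp add: scaleR_scaleC tensor_scaleC_right)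

lemma norm_tensor: "norm (tensor x y) = norm x * norm y"
proof -
  have "cinner (tensor x y) (tensor x y) = cinner x x * cinner y y"
    using tensor unfolding hilbert_tensor_product_def by blast
  then have "(norm (tensor x y))\<^sup>2 = (norm x * norm y)\<^sup>2"
    unfolding cinner_same by (metis of_real_eq_iff of_real_mult power_mult_distrib)
  then show ?thesis
    by (simp add: power2_eq_iff_nonneg)
qed

lemma bounded_linear_tensor_right: "bounded_linear (tensor x)"
  by (rule bounded_linear_intro[where K = "norm x"])
    (simp_all add: tensor_add_right tensor_scaleR_right norm_tensor mult.commute)

lemma is_id_tensor_zero: "is_id_tensor tensor 0 0"
  using linear_0[OF bounded_linear.linear[OF bounded_linear_tensor_right]]
  by (simp add: is_id_tensor_def)

lemma is_id_tensor_one: "is_id_tensor tensor 1 1"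
  by (simp add: is_id_tensor_def)

lemma is_id_tensor_add:
  "is_id_tensor tensor B A \<Longrightarrow> is_id_tensor tensor B' A' \<Longrightarrow> is_id_tensor tensor (B + B') (A + A')"
  by (simp add: is_id_tensor_def tensor_add_right)

lemma is_id_tensor_scaleR: "is_id_tensor tensor B A \<Longrightarrow> is_id_tensor tensor (r *\<^sub>R B) (r *\<^sub>R A)"
  by (simp add: is_id_tensor_def tensor_scaleR_right)

lemma is_id_tensor_scaleC: "is_id_tensor tensor B A \<Longrightarrow> is_id_tensor tensor (c *\<^sub>C B) (c *\<^sub>C A)"
  by (simp add: is_id_tensor_def tensor_scaleC_right)

lemma is_id_tensor_mult:
  "is_id_tensor tensor B A \<Longrightarrow> is_id_tensor tensor B' A' \<Longrightarrow> is_id_tensor tensor (B * B') (A * A')"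
  by (simp add: is_id_tensor_def)

lemma is_id_tensor_power: "is_id_tensor tensor B A \<Longrightarrow> is_id_tensor tensor (B ^ k) (A ^ k)"
  by (induction k) (simp_all add: is_id_tensor_one is_id_tensor_mult)

text \<open>On a product vector the two exponential series agree term by term; evaluation at a
  vector and \<open>tensor x\<close> are continuous, so the sums agree as well.\<close>

lemma is_id_tensor_op_exp:
  assumes "is_id_tensor tensor B A"
  shows "is_id_tensor tensor (op_exp B) (op_exp A)"
  unfolding is_id_tensor_def
proof (intro allI)
  fix x y
  have eq: "apply_op (A ^ k /\<^sub>R fact k) (tensor x y) = tensor x (apply_op (B ^ k /\<^sub>R fact k) y)" for k
    using is_id_tensor_scaleR[OF is_id_tensor_power[OF assms, of k]]
    unfolding is_id_tensor_def by blast
  have "(\<lambda>k. apply_op (A ^ k /\<^sub>R fact k) (tensor x y)) sums apply_op (op_exp A) (tensor x y)"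
    by (rule bounded_linear.sums[OF bounded_linear_apply_op op_exp_sums])
  moreover have "(\<lambda>k. tensor x (apply_op (B ^ k /\<^sub>R fact k) y)) sums tensor x (apply_op (op_exp B) y)"
    by (intro bounded_linear.sums[OF bounded_linear_tensor_right]
        bounded_linear.sums[OF bounded_linear_apply_op] op_exp_sums)
  ultimately show "apply_op (op_exp A) (tensor x y) = tensor x (apply_op (op_exp B) y)"
    unfolding eq by (rule sums_unique2)
qed

lemma subspace_pure_bath: "subspace (Collect (pure_bath tensor))"
  unfolding subspace_def pure_bath_def
  using is_id_tensor_zero is_id_tensor_add is_id_tensor_scaleR by blast

lemma pure_bath_one: "pure_bath tensor 1"
  unfolding pure_bath_def using is_id_tensor_one by blast

lemma pure_bath_mult: "pure_bath tensor A \<Longrightarrow> pure_bath tensor A' \<Longrightarrow> pure_bath tensor (A * A')"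
  unfolding pure_bath_def using is_id_tensor_mult by blast

end

section \<open>Truncation of the Dyson series\<close>

lemma piecewise_continuous_on_bounded_linear:
  assumes "bounded_linear L" "piecewise_continuous_on a b f"
  shows "piecewise_continuous_on a b (\<lambda>t. L (f t))"
proof -
  have "\<exists>l. ((\<lambda>t. L (f t)) \<longlongrightarrow> l) F" if "\<exists>l. (f \<longlongrightarrow> l) F" for F
    using that bounded_linear.tendsto[OF assms(1)] by blast
  moreover have "continuous_on S (\<lambda>t. L (f t))" if "continuous_on S f" for S
    by (rule bounded_linear.continuous_on[OF assms(1) that])
  ultimately show ?thesis
    using assms(2) unfolding piecewise_continuous_on_def by metis
qed

text \<open>The differential equation, valid off a finite set, integrates to the Volterra equation
  because \<open>U\<close> is continuous. The factor \<open>-\<i>\<close> goes into the generator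
  while \<open>s\<close> stays a real scalar, so one family of Dyson terms serves every
  \<open>s\<close>.\<close>

lemma evolution_dyson_sums:
  fixes H :: "real \<Rightarrow> 'a::chilbert_space bounded_op"
  assumes U: "is_evolution (\<lambda>t. s *\<^sub>R H t) T U"
    and H: "piecewise_continuous_on 0 T H" "\<And>t. t \<in> {0..T} \<Longrightarrow> norm (H t) \<le> K" and "0 \<le> T"
  shows "(\<lambda>m. s ^ m *\<^sub>R dyson (\<lambda>t. (- \<i>) *\<^sub>C H t) m T) sums U T"
proof (rule volterra_eq_dyson_series)
  show "piecewise_continuous_on 0 T (\<lambda>t. (- \<i>) *\<^sub>C H t)"
    by (rule piecewise_continuous_on_bounded_linear[OF bounded_linear_scaleC_bounded_op H(1)])
  show "norm ((- \<i>) *\<^sub>C H t) \<le> K" if "t \<in> {0..T}" for t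
    using norm_scaleC_bounded_op_le[of "- \<i>" "H t"] H(2)[OF that] by simp
  show cont: "continuous_on {0..T} U"
    using U unfolding is_evolution_def by blast
  obtain F where "finite F" and U': "\<And>t. t \<in> {0..T} - F \<Longrightarrow>
      (U has_vector_derivative (- \<i>) *\<^sub>C (s *\<^sub>R H t * U t)) (at t within {0..T})"
    using U unfolding is_evolution_def by blast
  fix t assume t: "t \<in> {0..T}"
  have "((\<lambda>\<tau>. s *\<^sub>R ((- \<i>) *\<^sub>C H \<tau> * U \<tau>)) has_integral U t - U 0) {0..t}"
  \<comment> \<open>Removing \<open>0\<close> and \<open>t\<close> leaves interior points of
    \<open>{0..T}\<close>, where the derivative within the interval is two-sided.\<close>
  proof (rule fundamental_theorem_of_calculus_strong[where S = "F \<union> {0, t}"])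
    fix x assume x: "x \<in> {0..t} - (F \<union> {0, t})"
    then have "at x within {0..T} = at x"
      using t by (intro at_within_interior) (auto simp: interior_atLeastAtMost_real)
    moreover have "(- \<i>) *\<^sub>C (s *\<^sub>R H x * U x) = s *\<^sub>R ((- \<i>) *\<^sub>C H x * U x)"
      by (simp add: scaleC_mult_left scaleC_scaleR_commute)
    ultimately show "(U has_vector_derivative s *\<^sub>R ((- \<i>) *\<^sub>C H x * U x)) (at x)"
      using U'[of x] x t by auto
  qed (use \<open>finite F\<close> t continuous_on_subset[OF cont] in auto)
  then show "((\<lambda>\<tau>. s *\<^sub>R ((- \<i>) *\<^sub>C H \<tau> * U \<tau>)) has_integral U t - 1) {0..t}"
    using U by (simp add: is_evolution_def)
qed (rule \<open>0 \<le> T\<close>)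

text \<open>Absolute summability makes the unordered sum agree with the ordered one, after a shift
  of the index set to all naturals.\<close>

lemma infsum_atLeast_eq_suminf:
  fixes f :: "nat \<Rightarrow> 'a::banach"
  assumes "summable (\<lambda>m. norm (f (m + k)))"
  shows "infsum f {k..} = (\<Sum>m. f (m + k))"
proof -
  have "range (\<lambda>m. m + k) = {k..}"
    by (auto simp: image_iff) (metis le_add_diff_inverse2)
  then have "infsum f {k..} = infsum (\<lambda>m. f (m + k)) UNIV"
    using infsum_reindex[of "\<lambda>m. m + k" UNIV f] by (simp add: o_def)
  also have "\<dots> = (\<Sum>m. f (m + k))"
    using norm_summable_imp_has_sum[OF assms] assms
    by (intro infsumI) (auto intro: summable_sums summable_norm_cancel)
  finally show ?thesis .
qed

theorem mainTheorem4:
  fixes tensor :: "'s::chilbert_space \<Rightarrow> 'b::chilbert_space \<Rightarrow> 'h::chilbert_space"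
    and H H_err U :: "real \<Rightarrow> 'h bounded_op"
    and H_B :: "'h bounded_op" and B\<^sub>0 :: "'b bounded_op"
    and \<Omega> :: "nat \<Rightarrow> 'h bounded_op"
    and T \<beta> J \<epsilon> :: real and n :: nat
  assumes "hilbert_tensor_product tensor"
    and "0 \<le> T"
    and "\<And>t. t \<in> {0..T} \<Longrightarrow> H t = H_B + H_err t"
    and "\<And>t. t \<in> {0..T} \<Longrightarrow> hermitian (H t)"
    and "piecewise_continuous_on 0 T H"
    and "is_id_tensor tensor B\<^sub>0 H_B"
    and "norm H_B \<le> \<beta>"
    and "\<And>t. t \<in> {0..T} \<Longrightarrow> norm (H_err t) \<le> J"
    and "\<epsilon> = \<beta> + J"
    and "is_evolution H T U"
    and "n \<ge> 1"
    and "magnus_terms H T \<Omega>"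
    and "\<And>k. k \<in> {1..n} \<Longrightarrow> pure_bath tensor (\<Omega> k)"
  shows "\<exists>B A. is_id_tensor tensor B A \<and>
    norm (U T - A) \<le> (\<Sum>\<^sub>\<infinity>m\<in>{n+1..}. 1 / fact (m - 1) * (J * T) * (\<epsilon> * T) ^ (m - 1))"
proof -
  note tensor = assms(1)
  define V where "V = Collect (pure_bath tensor)"
  define D where "D m = dyson (\<lambda>t. (- \<i>) *\<^sub>C H t) m T" for m
  define A\<^sub>0 where "A\<^sub>0 = (- \<i>) *\<^sub>C H_B"
  define P where "P m = (T ^ m / fact m) *\<^sub>R A\<^sub>0 ^ m" for m
  define f where "f m = 1 / fact (m - 1) * (J * T) * (\<epsilon> * T) ^ (m - 1)" for m :: nat
  have V: "subspace V" "1 \<in> V" "\<And>a b. a \<in> V \<Longrightarrow> b \<in> V \<Longrightarrow> a * b \<in> V"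
    using subspace_pure_bath[OF tensor] pure_bath_one pure_bath_mult[OF tensor] tensor
    by (auto simp: V_def)
  have "0 \<le> J"
    using assms(8)[of 0] \<open>0 \<le> T\<close> by (auto intro: order_trans[OF norm_ge_zero])
  have "0 \<le> \<beta>"
    using \<open>norm H_B \<le> \<beta>\<close> norm_ge_zero order_trans by blast
  have H_le: "norm (H t) \<le> \<epsilon>" if "t \<in> {0..T}" for t
    using assms(3,7,8,9) that by (simp add: norm_triangle_mono)
  \<comment> \<open>Valid for every scale \<open>s\<close> and every evolution at that scale: small
    \<open>s\<close> gives access to the Magnus exponent, \<open>s = 1\<close> to \<open>U\<close>
    itself.\<close>
  note sums = evolution_dyson_sums[OF _ assms(5) H_le \<open>0 \<le> T\<close>, folded D_def]

  have D_pure: "D k \<in> V" if "k \<le> n" for k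
  proof -
    obtain r where "r > 0" and r: "\<And>s::real. \<bar>s\<bar> < r \<Longrightarrow>
        summable (\<lambda>k. s ^ Suc k *\<^sub>R \<Omega> (Suc k)) \<and>
        (\<exists>U. is_evolution (\<lambda>t. s *\<^sub>R H t) T U \<and> U T = op_exp (\<Sum>k. s ^ Suc k *\<^sub>R \<Omega> (Suc k)))"
      using assms(12) unfolding magnus_terms_def by blast
    show ?thesis
    proof (rule powser_coeff_in_of_exp_powser[OF norm_one_bounded_op_le V \<open>r > 0\<close>, where \<Omega> = \<Omega> and n = n])
      \<comment> \<open>The evolution supplied with the Magnus expansion at scale \<open>s\<close>
        has the same Dyson coefficients \<open>D k\<close>.\<close>
      show "(\<lambda>k. s ^ k *\<^sub>R D k) sums (\<Sum>j. (\<Sum>k. s ^ Suc k *\<^sub>R \<Omega> (Suc k)) ^ j /\<^sub>R fact j)"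
        if "\<bar>s\<bar> < r" for s
        using r[OF that] sums unfolding op_exp_def by metis
    qed (use r assms(13) \<open>k \<le> n\<close> in \<open>auto simp: V_def\<close>)
  qed

  have A\<^sub>0: "is_id_tensor tensor ((- \<i>) *\<^sub>C B\<^sub>0) A\<^sub>0"
    unfolding A\<^sub>0_def by (rule is_id_tensor_scaleC[OF tensor assms(6)])
  then have "P m \<in> V" for m
    unfolding P_def V_def pure_bath_def
    using is_id_tensor_scaleR[OF tensor is_id_tensor_power[OF tensor]] by blast
  moreover have "op_exp (T *\<^sub>R A\<^sub>0) \<in> V"
    unfolding V_def pure_bath_def
    using is_id_tensor_op_exp[OF tensor is_id_tensor_scaleR[OF tensor A\<^sub>0]] by blast
  \<comment> \<open>This operator is the sum of \<open>D m\<close> for \<open>m \<le> n\<close> and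
    of \<open>P m\<close> for \<open>m > n\<close>. The infinite part enters through
    \<open>op_exp\<close>, already known to be pure-bath, so only finite sums are formed in
    \<open>V\<close>.\<close>
  ultimately have A_pure: "(\<Sum>m<n+1. D m - P m) + op_exp (T *\<^sub>R A\<^sub>0) \<in> V"
    using D_pure by (intro subspace_add subspace_sum subspace_diff V(1)) auto

  \<comment> \<open>\<open>P\<close> is the exponential series of the evolution generated by
    \<open>H_B\<close> alone.\<close>
  have "(\<lambda>m. (T *\<^sub>R A\<^sub>0) ^ m /\<^sub>R fact m) = P"
    by (auto simp: P_def power_scaleR_monoid divide_inverse mult.commute)
  then have "P sums op_exp (T *\<^sub>R A\<^sub>0)"
    using op_exp_sums[of "T *\<^sub>R A\<^sub>0"] by simp
  moreover have "D sums U T"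
    using sums[of 1 U] assms(10) by simp
  ultimately have DP: "(\<lambda>m. D m - P m) sums (U T - op_exp (T *\<^sub>R A\<^sub>0))"
    by (rule sums_diff[rotated])

  \<comment> \<open>Indices are written as \<open>m + (n + 1)\<close>, so the subtraction of 1 in
    \<open>f\<close> is never truncated.\<close>
  have le_f: "norm (D (m + (n + 1)) - P (m + (n + 1))) \<le> f (m + (n + 1))" for m
  proof -
    have "norm (D (m + (n + 1)) - P (m + (n + 1)))
        \<le> real (m + (n + 1)) * J * (\<beta> + J) ^ (m + (n + 1) - 1) * T ^ (m + (n + 1)) / fact (m + (n + 1))"
      unfolding D_def P_def
    proof (rule norm_dyson_minus_power_le[OF norm_one_bounded_op_le, where E = "\<lambda>t. (- \<i>) *\<^sub>C H_err t"])
      show "piecewise_continuous_on 0 T (\<lambda>t. (- \<i>) *\<^sub>C H t)"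
        by (rule piecewise_continuous_on_bounded_linear[OF bounded_linear_scaleC_bounded_op assms(5)])
      show "(- \<i>) *\<^sub>C H t = A\<^sub>0 + (- \<i>) *\<^sub>C H_err t" if "t \<in> {0..T}" for t
        using assms(3)[OF that] by (simp add: A\<^sub>0_def scaleC_add_right)
      show "norm A\<^sub>0 \<le> \<beta>"
        using norm_scaleC_bounded_op_le[of "- \<i>" H_B] assms(7) by (simp add: A\<^sub>0_def)
      show "norm ((- \<i>) *\<^sub>C H_err t) \<le> J" if "t \<in> {0..T}" for t
        using norm_scaleC_bounded_op_le[of "- \<i>" "H_err t"] assms(8)[OF that] by simp
    qed (use \<open>0 \<le> T\<close> in simp)
    also have "\<dots> = f (m + (n + 1))"
    proof -
      \<comment> \<open>The factor \<open>Suc k\<close> cancels against \<open>fact (Suc k)\<close>,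
        and \<open>T ^ Suc k\<close> splits into one \<open>T\<close> for \<open>J\<close> and
        \<open>k\<close> of them for \<open>\<epsilon>\<close>.\<close>
      have "real (Suc k) * J * \<epsilon> ^ k * T ^ Suc k / fact (Suc k) = 1 / fact k * (J * T) * (\<epsilon> * T) ^ k" for k
        by (simp add: power_mult_distrib mult_ac del: of_nat_Suc)
      from this[of "m + n"] show ?thesis
        by (simp add: f_def \<open>\<epsilon> = \<beta> + J\<close> del: fact_Suc of_nat_Suc power_Suc)
    qed
    finally show ?thesis .
  qed
  have f_summable: "summable (\<lambda>m. norm (f (m + (n + 1))))"
  proof -
    have "summable (\<lambda>m. J * T * ((\<epsilon> * T) ^ (m + n) /\<^sub>R fact (m + n)))"
      by (intro summable_mult summable_ignore_initial_segment summable_exp_generic)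
    moreover have "norm (f (m + (n + 1))) = J * T * ((\<epsilon> * T) ^ (m + n) /\<^sub>R fact (m + n))" for m
      using \<open>0 \<le> J\<close> \<open>0 \<le> \<beta>\<close> \<open>0 \<le> T\<close> \<open>\<epsilon> = \<beta> + J\<close> by (simp add: f_def abs_mult divide_inverse)
    ultimately show ?thesis
      by simp
  qed
  \<comment> \<open>The approximant contains exactly the first \<open>n + 1\<close> differences, so
    only the tail remains.\<close>
  have "U T - ((\<Sum>m<n+1. D m - P m) + op_exp (T *\<^sub>R A\<^sub>0)) = (\<Sum>m. D (m + (n + 1)) - P (m + (n + 1)))"
    using suminf_minus_initial_segment[OF sums_summable[OF DP], of "n + 1"] sums_unique[OF DP]
    by (simp add: algebra_simps)
  also have "norm \<dots> \<le> (\<Sum>m. f (m + (n + 1)))"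
    by (rule norm_suminf_le[OF le_f summable_norm_cancel[OF f_summable]])
  also have "\<dots> = (\<Sum>\<^sub>\<infinity>m\<in>{n+1..}. f m)"
    by (rule infsum_atLeast_eq_suminf[OF f_summable, symmetric])
  finally show ?thesis
    using A_pure unfolding V_def pure_bath_def f_def by blast
qed

end
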